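(* Let $f:\mathbb{R}\to\mathbb{R}$ satisfy (A1) and (A2). For a map $S:\mathbb{R}\times[0,+\infty[\,\to\mathbb{R}$, $(x_0,t)\mapsto S_t(x_0)$, the following are equivalent: (i) $S$ is a deterministic semigroup compatible with the ODE $\dot x=f(x)$; (ii) there exist a positive atomless Borel measure $\mu$ supported on $f^{-1}(0)$, a countable set $\mathcal{S}\subseteq f^{-1}(0)$, and a map $\Phi:\Omega^*\to\{-1,1\}$ such that $S$ coincides with the semigroup constructed from $(\mu,\mathcal{S},\Phi)$ as described in the context.
   Context: (A1): $f$ is bounded and regulated (left and right limits $f(x\pm)$ exist everywhere). (A2): if $f(y-)\cdot f(y+)=0$ or $f(y-)>0>f(y+)$, then $f(y)=0$. A Carathéodory solution of $\dot x=f(x)$, $x(0)=x_0$ is a function with $x(t)=x_0+\int_0^tf(x(s))\,ds$ for all $t\ge0$. A deterministic semigroup compatible with $\dot x=f(x)$ is a map $S:\mathbb{R}\times[0,\infty[\to\mathbb{R}$ with $S_0(x_0)=x_0$, $S_t(S_s(x_0))=S_{t+s}(x_0)$ for all $s,t\ge0$, $x_0\in\mathbb{R}$, and such that for each $x_0$ the map $t\mapsto S_t(x_0)$ is a Carathéodory solution starting at $x_0$ (no continuity in $x_0$ is required). Notation: $f^+=\max\{f,0\}$, $f^-=\min\{f,0\}$, with $1/f^+=+\infty$ where $f\le0$ and $1/f^-=-\infty$ where $f\ge 0$. $\mathcal{R}^-=\{x:\int_{x-\varepsilon}^x \frac{dy}{f^-(y)}>-\infty \text{ for some }\varepsilon>0\}$,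 $\mathcal{R}^+=\{x:\int_x^{x+\varepsilon}\frac{dy}{f^+(y)}<+\infty\text{ for some }\varepsilon>0\}$, $\Omega^*=\mathcal{R}^-\cap\mathcal{R}^+$. Construction from $(\mu,\mathcal{S},\Phi)$: an open interval $]a,b[$ is a domain of increase if $]a,b[\cap\mathcal{S}=\emptyset$ and $\mu([c,d])+\int_c^d\frac{dx}{f^+(x)}<\infty$ for all $[c,d]\subset]a,b[$; it is a domain of decrease if $]a,b[\cap\mathcal{S}=\emptyset$ and $\mu([c,d])-\int_c^d\frac{dx}{f^-(x)}<\infty$ for all $[c,d]\subset]a,b[$. Let $]\alpha_i,\beta_i[$ ($i\in\mathcal{I}^+$) be the disjoint maximal domains of increase and $]\gamma_i,\delta_i[$ ($i\in\mathcal{I}^-$) the disjoint maximal domains of decrease. Set $I_i^+=[\alpha_i,\beta_i[$ if $\alpha_i\notin\mathcal{S}$ and $\mu([\alpha_i,\alpha_i+\varepsilon])+\int_{\alpha_i}^{\alpha_i+\varepsilon}\frac{dx}{f^+(x)}<\infty$ for some $\varepsilon>0$, and $I_i^+=]\alpha_i,\beta_i[$ otherwise; set $I_i^-=]\gamma_i,\delta_i]$ if $\delta_i\notin\mathcal{S}$ and $\mu([\delta_i-\varepsilon,\delta_i])-\int_{\delta_i-\varepsilon}^{\delta_i}\frac{dx}{f^-(x)}<\infty$ for some $\varepsilon>0$, and $I_i^-=]\gamma_i,\delta_i[$ otherwise. For $x_0\in I_i^+$ let $\tau^+(x_0)=\mu([x_0,\beta_i])+\int_{x_0}^{\beta_i}\frac{dy}{f^+(y)}\in]0,+\infty]$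 and define $S^+_t(x_0)=x(t)$ where $\mu([x_0,x(t)])+\int_{x_0}^{x(t)}\frac{dy}{f^+(y)}=t$ if $t<\tau^+(x_0)$, and $x(t)=\beta_i$ if $t\ge\tau^+(x_0)$. For $x_0\in I_i^-$ let $\tau^-(x_0)=\mu([\gamma_i,x_0])-\int_{\gamma_i}^{x_0}\frac{dy}{f^-(y)}$ and define $S^-_t(x_0)=x(t)$ where $\mu([x(t),x_0])-\int_{x(t)}^{x_0}\frac{dy}{f^-(y)}=t$ if $t<\tau^-(x_0)$, and $x(t)=\gamma_i$ if $t\ge\tau^-(x_0)$. Then $S_t(x_0)=x_0$ if $x_0\notin(\bigcup_iI_i^+)\cup(\bigcup_iI_i^-)$; $S_t(x_0)=S^+_t(x_0)$ if $x_0\in(\bigcup_iI_i^+)\setminus(\bigcup_iI_i^-)$; $S_t(x_0)=S^-_t(x_0)$ if $x_0\in(\bigcup_iI_i^-)\setminus(\bigcup_iI_i^+)$; and if $x_0\in(\bigcup_iI_i^+)\cap(\bigcup_iI_i^-)$ (which implies $x_0\in\Omega^*$), $S_t(x_0)=S^+_t(x_0)$ if $\Phi(x_0)=1$ and $S_t(x_0)=S^-_t(x_0)$ if $\Phi(x_0)=-1$. *)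

theory Defs
  imports "HOL-Analysis.Analysis"
begin

definition left_lim :: "(real \<Rightarrow> real) \<Rightarrow> real \<Rightarrow> real" where
  "left_lim f y = Lim (at_left y) f"

definition right_lim :: "(real \<Rightarrow> real) \<Rightarrow> real \<Rightarrow> real" where
  "right_lim f y = Lim (at_right y) f"

definition A1 :: "(real \<Rightarrow> real) \<Rightarrow> bool" where
  "A1 f \<longleftrightarrow> bounded (range f) \<and>
     (\<forall>x. (\<exists>l. (f \<longlongrightarrow> l) (at_left x)) \<and> (\<exists>l. (f \<longlongrightarrow> l) (at_right x)))"

definition A2 :: "(real \<Rightarrow> real) \<Rightarrow> bool" where
  "A2 f \<longleftrightarrow> (\<forall>y. (left_lim f y * right_lim f y = 0 \<or>
                      (left_lim f y > 0 \<and> 0 > right_lim f y)) \<longrightarrow> f y = 0)"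

definition caratheodory_sol :: "(real \<Rightarrow> real) \<Rightarrow> real \<Rightarrow> (real \<Rightarrow> real) \<Rightarrow> bool" where
  "caratheodory_sol f x0 x \<longleftrightarrow>
     (\<forall>t\<ge>0. ((\<lambda>s. f (x s)) has_integral (x t - x0)) {0..t})"

text \<open>S x0 t stands for S_t(x0); only t \<ge> 0 is relevant.\<close>
definition det_semigroup :: "(real \<Rightarrow> real) \<Rightarrow> (real \<Rightarrow> real \<Rightarrow> real) \<Rightarrow> bool" where
  "det_semigroup f S \<longleftrightarrow>
     (\<forall>x0. S x0 0 = x0) \<and>
     (\<forall>x0 s t. 0 \<le> s \<longrightarrow> 0 \<le> t \<longrightarrow> S (S x0 s) t = S x0 (t + s)) \<and>
     (\<forall>x0. caratheodory_sol f x0 (\<lambda>t. S x0 t))"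

text \<open>inv_fp y = 1/f^+(y), which is +\<infinity> where f \<le> 0;
  inv_fm y = -1/f^-(y), which is +\<infinity> where f \<ge> 0.\<close>
definition inv_fp :: "(real \<Rightarrow> real) \<Rightarrow> real \<Rightarrow> ennreal" where
  "inv_fp f y = (if f y > 0 then ennreal (1 / f y) else \<infinity>)"

definition inv_fm :: "(real \<Rightarrow> real) \<Rightarrow> real \<Rightarrow> ennreal" where
  "inv_fm f y = (if f y < 0 then ennreal (- 1 / f y) else \<infinity>)"

definition int_on :: "real set \<Rightarrow> (real \<Rightarrow> ennreal) \<Rightarrow> ennreal" where
  "int_on A g = (\<integral>\<^sup>+ y. indicator A y * g y \<partial>lborel)"

definition R_minus :: "(real \<Rightarrow> real) \<Rightarrow> real set" where
  "R_minus f = {x. \<exists>\<epsilon>>0. int_on {x - \<epsilon>..x} (inv_fm f) < \<infinity>}"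

definition R_plus :: "(real \<Rightarrow> real) \<Rightarrow> real set" where
  "R_plus f = {x. \<exists>\<epsilon>>0. int_on {x..x + \<epsilon>} (inv_fp f) < \<infinity>}"

definition Omega_star :: "(real \<Rightarrow> real) \<Rightarrow> real set" where
  "Omega_star f = R_minus f \<inter> R_plus f"

definition open_interval :: "real set \<Rightarrow> bool" where
  "open_interval D \<longleftrightarrow> open D \<and> is_interval D \<and> D \<noteq> {}"

definition dom_inc :: "(real \<Rightarrow> real) \<Rightarrow> real measure \<Rightarrow> real set \<Rightarrow> real set \<Rightarrow> bool" where
  "dom_inc f \<mu> Sg D \<longleftrightarrow> open_interval D \<and> D \<inter> Sg = {} \<and>
     (\<forall>c d. {c..d} \<subseteq> D \<longrightarrow> emeasure \<mu> {c..d} + int_on {c..d} (inv_fp f) < \<infinity>)"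

definition dom_dec :: "(real \<Rightarrow> real) \<Rightarrow> real measure \<Rightarrow> real set \<Rightarrow> real set \<Rightarrow> bool" where
  "dom_dec f \<mu> Sg D \<longleftrightarrow> open_interval D \<and> D \<inter> Sg = {} \<and>
     (\<forall>c d. {c..d} \<subseteq> D \<longrightarrow> emeasure \<mu> {c..d} + int_on {c..d} (inv_fm f) < \<infinity>)"

definition max_dom_inc :: "(real \<Rightarrow> real) \<Rightarrow> real measure \<Rightarrow> real set \<Rightarrow> real set \<Rightarrow> bool" where
  "max_dom_inc f \<mu> Sg D \<longleftrightarrow> dom_inc f \<mu> Sg D \<and>
     (\<forall>D'. dom_inc f \<mu> Sg D' \<and> D \<subseteq> D' \<longrightarrow> D' = D)"

definition max_dom_dec :: "(real \<Rightarrow> real) \<Rightarrow> real measure \<Rightarrow> real set \<Rightarrow> real set \<Rightarrow> bool" where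
  "max_dom_dec f \<mu> Sg D \<longleftrightarrow> dom_dec f \<mu> Sg D \<and>
     (\<forall>D'. dom_dec f \<mu> Sg D' \<and> D \<subseteq> D' \<longrightarrow> D' = D)"

definition I_plus :: "(real \<Rightarrow> real) \<Rightarrow> real measure \<Rightarrow> real set \<Rightarrow> real set \<Rightarrow> real set" where
  "I_plus f \<mu> Sg D = D \<union> {a. bdd_below D \<and> a = Inf D \<and> a \<notin> Sg \<and>
      (\<exists>\<epsilon>>0. emeasure \<mu> {a..a + \<epsilon>} + int_on {a..a + \<epsilon>} (inv_fp f) < \<infinity>)}"

definition I_minus :: "(real \<Rightarrow> real) \<Rightarrow> real measure \<Rightarrow> real set \<Rightarrow> real set \<Rightarrow> real set" where
  "I_minus f \<mu> Sg D = D \<union> {b. bdd_above D \<and> b = Sup D \<and> b \<notin> Sg \<and>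
      (\<exists>\<epsilon>>0. emeasure \<mu> {b - \<epsilon>..b} + int_on {b - \<epsilon>..b} (inv_fm f) < \<infinity>)}"

definition S_plus :: "(real \<Rightarrow> real) \<Rightarrow> real measure \<Rightarrow> real set \<Rightarrow> real \<Rightarrow> real \<Rightarrow> real" where
  "S_plus f \<mu> D x0 t =
     (let \<beta> = Sup (ereal ` D);
          G = (\<lambda>y. emeasure \<mu> {x0..y} + int_on {x0..y} (inv_fp f));
          B = {y. x0 \<le> y \<and> ereal y \<le> \<beta>};
          \<tau> = emeasure \<mu> B + int_on B (inv_fp f)
      in if ennreal t < \<tau> then (THE y. x0 \<le> y \<and> ereal y < \<beta> \<and> G y = ennreal t)
         else real_of_ereal \<beta>)"

definition S_minus :: "(real \<Rightarrow> real) \<Rightarrow> real measure \<Rightarrow> real set \<Rightarrow> real \<Rightarrow> real \<Rightarrow> real" where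
  "S_minus f \<mu> D x0 t =
     (let \<gamma> = Inf (ereal ` D);
          H = (\<lambda>y. emeasure \<mu> {y..x0} + int_on {y..x0} (inv_fm f));
          B = {y. \<gamma> \<le> ereal y \<and> y \<le> x0};
          \<tau> = emeasure \<mu> B + int_on B (inv_fm f)
      in if ennreal t < \<tau> then (THE y. y \<le> x0 \<and> \<gamma> < ereal y \<and> H y = ennreal t)
         else real_of_ereal \<gamma>)"

definition U_plus :: "(real \<Rightarrow> real) \<Rightarrow> real measure \<Rightarrow> real set \<Rightarrow> real set" where
  "U_plus f \<mu> Sg = \<Union>{I_plus f \<mu> Sg D | D. max_dom_inc f \<mu> Sg D}"

definition U_minus :: "(real \<Rightarrow> real) \<Rightarrow> real measure \<Rightarrow> real set \<Rightarrow> real set" where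
  "U_minus f \<mu> Sg = \<Union>{I_minus f \<mu> Sg D | D. max_dom_dec f \<mu> Sg D}"

text \<open>The semigroup constructed from (mu, Sg, Phi); the maximal domains are pairwise
  disjoint, so the domain chosen by SOME is the unique one containing x0.\<close>
definition constructed_semigroup ::
  "(real \<Rightarrow> real) \<Rightarrow> real measure \<Rightarrow> real set \<Rightarrow> (real \<Rightarrow> int) \<Rightarrow> real \<Rightarrow> real \<Rightarrow> real" where
  "constructed_semigroup f \<mu> Sg \<Phi> x0 t =
     (if x0 \<in> U_plus f \<mu> Sg \<and> (x0 \<notin> U_minus f \<mu> Sg \<or> \<Phi> x0 = 1)
      then S_plus f \<mu> (SOME D. max_dom_inc f \<mu> Sg D \<and> x0 \<in> I_plus f \<mu> Sg D) x0 t
      else if x0 \<in> U_minus f \<mu> Sg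
      then S_minus f \<mu> (SOME D. max_dom_dec f \<mu> Sg D \<and> x0 \<in> I_minus f \<mu> Sg D) x0 t
      else x0)"

end

theory Submission
  imports Defs "HOL-Probability.Distribution_Functions"
begin

text \<open>
  For data (mu, Sg) let N = mu + dy / f^+ be the measure of travel times to the right, and call y
  passable from x if [x,y] avoids Sg and has finite N-measure. All of the construction on the
  increasing side can be read off passability alone, so the maximal domains disappear; the
  decreasing side is obtained by the reflection x to -x.

  From the data to the semigroup: the constructed path X inverts y to N[x,y], hence it pushes
  Lebesgue measure on [0,t] to N restricted to [x, X t]. Integrating f against N = mu + dy / f^+
  leaves X t - x, because f vanishes mu-almost everywhere.

  From the semigroup to the data: an orbit that returns to a point is constant from then on, so
  orbits are strictly monotone until they hit the set Z of stationary points. The occupation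
  measures of overlapping orbits agree and glue, over countably many rational orbits, to one
  measure off Z; mu is its restriction to the zeros of f, plus infinity on every set that meets Z
  in an uncountable set. Sg collects the points of Z near which, on one side, Z is countable.
  A point of Z is then never passable: either it lies in Sg or N is infinite beside it.
\<close>

text \<open>A change of variables along the path is not directly available: f may jump, and a
  solution may spend positive time in zeros of f without stopping there. Both directions instead
  compare measures on half-lines \<open>{c<..}\<close>, for which only the time at which a monotone
  path crosses c is needed. Finite N forces f > 0 almost everywhere, so a point reached from the
  left never admits motion to the left; hence Phi is consulted only at the starting point. (A2)
  enters at the points outside all domains: f must vanish there, so that resting is a solution. In
  the converse, S need not be continuous in the initial point, and everything is drawn from the
  intermediate value theorem along single orbits. Z may be uncountable while Sg must be countable
  and mu atomless, so stationary points are blocked in two ways: charging uncountable parts of Z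
  with infinite mass keeps singletons null, and the stationary points that this misses on some side
  are only countably many.\<close>

section \<open>Measurability of regulated functions; measures from set functions\<close>

text \<open>\<open>B e\<close> is the set of points where the oscillation of f is at least e. The
  one-sided limits make the oscillation small on a punctured neighbourhood of every point, so
  \<open>B e\<close> has no limit point and is countable; f is continuous off the countable union of
  these sets.\<close>

lemma regulated_borel_measurable:
  fixes f :: "real \<Rightarrow> real"
  assumes lim: "\<And>x. \<exists>l. (f \<longlongrightarrow> l) (at_left x)" "\<And>x. \<exists>l. (f \<longlongrightarrow> l) (at_right x)"
  shows "f \<in> borel_measurable borel"
proof -
  define B where "B e = {x. \<forall>\<delta>>0. \<exists>u v. \<bar>u - x\<bar> < \<delta> \<and> \<bar>v - x\<bar> < \<delta> \<and> e \<le> \<bar>f u - f v\<bar>}" for e :: real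
  have near: "x \<notin> B e" if "a < x" "x < b" "\<And>u. a < u \<Longrightarrow> u < b \<Longrightarrow> \<bar>f u - l\<bar> < e / 2" for a b x l e
  proof -
    have *: "\<not> e \<le> \<bar>f u - f v\<bar>" if "\<bar>u - x\<bar> < min (x - a) (b - x)" "\<bar>v - x\<bar> < min (x - a) (b - x)" for u v
    proof -
      have "\<bar>f u - l\<bar> < e / 2" "\<bar>f v - l\<bar> < e / 2"
        using that \<open>\<And>u. a < u \<Longrightarrow> u < b \<Longrightarrow> \<bar>f u - l\<bar> < e / 2\<close> by auto
      then show ?thesis by linarith
    qed
    have "min (x - a) (b - x) > 0" using that by auto
    with * show ?thesis unfolding B_def mem_Collect_eq by blast
  qed
  have "\<not> y islimpt B e" if "e > 0" for y e
  proof -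
    obtain l where "(f \<longlongrightarrow> l) (at_left y)" using lim by blast
    from tendstoD[OF this, of "e/2"] \<open>e > 0\<close> obtain a where a: "a < y" "\<And>u. a < u \<Longrightarrow> u < y \<Longrightarrow> \<bar>f u - l\<bar> < e/2"
      by (auto simp: eventually_at_left_field dist_real_def)
    obtain r where "(f \<longlongrightarrow> r) (at_right y)" using lim by blast
    from tendstoD[OF this, of "e/2"] \<open>e > 0\<close> obtain b where b: "y < b" "\<And>u. y < u \<Longrightarrow> u < b \<Longrightarrow> \<bar>f u - r\<bar> < e/2"
      by (auto simp: eventually_at_right_field dist_real_def)
    have "x \<notin> B e" if "x \<in> {a<..<b}" "x \<noteq> y" for x
      using near[of a x y l e] near[of y x b r e] a b that by fastforce
    moreover have "open {a<..<b}" "y \<in> {a<..<b}" using a b by auto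
    ultimately show ?thesis unfolding islimpt_def by blast
  qed
  then have "countable (B e)" if "e > 0" for e
    using sparse_imp_countable[of UNIV "B e"] that open_UNIV unfolding sparse_in_def Int_UNIV_left by blast
  then have cnt: "countable (\<Union>n. B (inverse (Suc n)))" by auto
  have "continuous_on (- (\<Union>n. B (inverse (Suc n)))) f"
    unfolding continuous_on_eq_continuous_within
  proof
    fix x assume x: "x \<in> - (\<Union>n. B (inverse (Suc n)))"
    have "\<exists>\<delta>>0. \<forall>u. dist u x < \<delta> \<longrightarrow> dist (f u) (f x) < e" if "e > 0" for e
    proof -
      obtain n where n: "inverse (Suc n) < e" using reals_Archimedean[OF \<open>e > 0\<close>] by auto
      have "x \<notin> B (inverse (Suc n))" using x by auto
      then obtain \<delta> where \<delta>: "\<delta> > 0" "\<And>u v. \<bar>u - x\<bar> < \<delta> \<Longrightarrow> \<bar>v - x\<bar> < \<delta> \<Longrightarrow> \<bar>f u - f v\<bar> < inverse (Suc n)"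
        unfolding B_def by (auto simp: not_le)
      have "dist (f u) (f x) < e" if "dist u x < \<delta>" for u
        using \<delta>(2)[of u x] n that \<delta>(1) by (simp add: dist_real_def)
      then show ?thesis using \<delta>(1) by blast
    qed
    then have "isCont f x" unfolding continuous_at_eps_delta by simp
    then show "continuous (at x within - (\<Union>n. B (inverse (Suc n)))) f"
      by (rule continuous_at_imp_continuous_at_within)
  qed
  from borel_measurable_continuous_countable_exceptions[OF cnt this] show ?thesis .
qed

lemma ex_borel_measure:
  fixes m :: "real set \<Rightarrow> ennreal"
  assumes "m {} = 0"
    and "\<And>A. range A \<subseteq> sets borel \<Longrightarrow> disjoint_family A \<Longrightarrow> m (\<Union>i::nat. A i) = (\<Sum>i. m (A i))"
  shows "\<exists>M. sets M = sets borel \<and> (\<forall>A\<in>sets borel. emeasure M A = m A)"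
proof (intro exI conjI ballI)
  let ?M = "measure_of UNIV (sets borel) m"
  show s: "sets ?M = sets borel" using sets.sigma_sets_eq[of borel] by simp
  have ca: "countably_additive (sets borel) m"
    using assms(2) by (auto simp: countably_additive_def)
  fix A :: "real set" assume A: "A \<in> sets borel"
  show "emeasure ?M A = m A"
    by (rule emeasure_measure_of_sigma[OF _ _ ca A])
       (use assms(1) sets.sigma_algebra_axioms[of borel] in \<open>auto simp: positive_def\<close>)
qed

lemma ex_sum_measure:
  fixes M N :: "real measure"
  assumes "sets M = sets borel" "sets N = sets borel"
  shows "\<exists>Q. sets Q = sets borel \<and> (\<forall>A\<in>sets borel. emeasure Q A = emeasure M A + emeasure N A)"
proof (rule ex_borel_measure)
  fix A :: "nat \<Rightarrow> real set" assume A: "range A \<subseteq> sets borel" "disjoint_family A"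
  have "emeasure M (\<Union>i. A i) = (\<Sum>i. emeasure M (A i))" "emeasure N (\<Union>i. A i) = (\<Sum>i. emeasure N (A i))"
    using A assms by (auto intro!: suminf_emeasure[symmetric])
  then show "emeasure M (\<Union>i. A i) + emeasure N (\<Union>i. A i) = (\<Sum>i. emeasure M (A i) + emeasure N (A i))"
    by (simp add: suminf_add)
qed simp

lemma A1_measurable: "A1 f \<Longrightarrow> f \<in> borel_measurable borel"
  unfolding A1_def by (rule regulated_borel_measurable) auto

lemma A1_bound:
  assumes "A1 f" obtains K where "K > 0" "\<And>x. \<bar>f x\<bar> \<le> K"
  using assms bounded_pos[of "range f"] unfolding A1_def by auto

lemma inv_fp_measurable [measurable]:
  assumes [measurable]: "f \<in> borel_measurable borel"
  shows "inv_fp f \<in> borel_measurable borel"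
  unfolding inv_fp_def by measurable

lemma int_on_eq_density:
  assumes "g \<in> borel_measurable borel" "A \<in> sets borel"
  shows "int_on A g = emeasure (density lborel g) A"
  using assms unfolding int_on_def by (simp add: emeasure_density mult.commute)

section \<open>The travel-time measure of the data\<close>

locale flow_data =
  fixes f :: "real \<Rightarrow> real" and \<mu> :: "real measure" and Sg :: "real set"
  assumes A1: "A1 f" and sets_mu: "sets \<mu> = sets borel"
    and atomless: "\<And>x. emeasure \<mu> {x} = 0"
    and supp: "emeasure \<mu> (UNIV - f -` {0}) = 0"
    and Sg_zero: "Sg \<subseteq> f -` {0}"
begin

lemma f_meas [measurable]: "f \<in> borel_measurable borel"
  using A1 by (rule A1_measurable)

text \<open>The N-measure of an interval is the time needed to cross it to the right.\<close>
definition N :: "real measure" where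
  "N = (SOME N. sets N = sets borel \<and>
     (\<forall>A\<in>sets borel. emeasure N A = emeasure \<mu> A + emeasure (density lborel (inv_fp f)) A))"

lemma sets_N [simp, measurable_cong]: "sets N = sets borel"
  and emeasure_N_density:
    "A \<in> sets borel \<Longrightarrow> emeasure N A = emeasure \<mu> A + emeasure (density lborel (inv_fp f)) A"
  using someI_ex[OF ex_sum_measure[OF sets_mu, of "density lborel (inv_fp f)"], folded N_def]
  by auto

lemma emeasure_N:
  "A \<in> sets borel \<Longrightarrow> emeasure N A = emeasure \<mu> A + int_on A (inv_fp f)"
  by (simp add: emeasure_N_density int_on_eq_density)

lemma N_singleton [simp]: "emeasure N {x} = 0"
  by (simp add: emeasure_N_density atomless emeasure_density nn_integral_null_set
      null_sets_def)

text \<open>The speed is bounded by K, so \<open>inv_fp f\<close> is at least 1/K everywhere. This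
  makes N strictly increasing along intervals and excludes an escape to infinity in finite
  time.\<close>

lemma N_lower:
  obtains k where "k > 0" "\<And>c d. c \<le> d \<Longrightarrow> ennreal (k * (d - c)) \<le> emeasure N {c..d}"
proof -
  obtain K where K: "K > 0" "\<And>x. \<bar>f x\<bar> \<le> K" using A1_bound[OF A1] by blast
  have inv: "ennreal (1 / K) \<le> inv_fp f y" for y
    using K(1) K(2)[of y] by (auto simp: inv_fp_def ennreal_leI frac_le)
  have "ennreal (1 / K * (d - c)) \<le> emeasure N {c..d}" if "c \<le> d" for c d
  proof -
    have "ennreal (1 / K * (d - c)) = (\<integral>\<^sup>+y. ennreal (1/K) * indicator {c..d} y \<partial>lborel)"
      using that K by (simp add: nn_integral_cmult_indicator flip: ennreal_mult)
    also have "\<dots> \<le> int_on {c..d} (inv_fp f)"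
      unfolding int_on_def
      by (intro nn_integral_mono) (auto simp: inv split: split_indicator)
    also have "\<dots> \<le> emeasure N {c..d}" by (simp add: emeasure_N)
    finally show ?thesis .
  qed
  then show ?thesis using that[of "1/K"] K(1) by auto
qed

text \<open>\<open>inv_fp f\<close> is infinite wherever f <= 0, so a finite integral leaves only a
  null set of such points.\<close>

lemma AE_pos:
  assumes "emeasure N {x..y} < \<infinity>"
  shows "AE z in lborel. z \<in> {x..y} \<longrightarrow> f z > 0"
proof -
  have "int_on {x..y} (inv_fp f) \<noteq> \<infinity>" using assms by (auto simp: emeasure_N)
  then have "AE z in lborel. indicator {x..y} z * inv_fp f z \<noteq> \<infinity>"
    unfolding int_on_def by (intro nn_integral_noteq_infinite[of _ lborel]) auto
  then show ?thesis by eventually_elim (auto simp: inv_fp_def split: if_splits)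
qed

lemma N_split:
  assumes "x \<le> y" "y \<le> z"
  shows "emeasure N {x..z} = emeasure N {x..y} + emeasure N {y..z}"
proof -
  have "emeasure N {y..z} = emeasure N {y} + emeasure N {y<..z}"
    using assms by (subst plus_emeasure) (auto intro!: arg_cong[of _ _ "emeasure N"])
  moreover have "emeasure N {x..z} = emeasure N {x..y} + emeasure N {y<..z}"
    using assms by (subst plus_emeasure) (auto intro!: arg_cong[of _ _ "emeasure N"])
  ultimately show ?thesis by simp
qed

lemma N_strict:
  assumes "x \<le> y" "y < z" "emeasure N {x..y} < \<infinity>"
  shows "emeasure N {x..y} < emeasure N {x..z}"
proof -
  obtain k where "k > 0" "\<And>c d. c \<le> d \<Longrightarrow> ennreal (k * (d - c)) \<le> emeasure N {c..d}"
    using N_lower by blast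
  then have "0 < ennreal (k * (z - y))" "ennreal (k * (z - y)) \<le> emeasure N {y..z}" using assms by auto
  then have "0 < emeasure N {y..z}" by (rule less_le_trans)
  then have "emeasure N {x..y} + 0 < emeasure N {x..y} + emeasure N {y..z}"
    using assms by (subst ennreal_add_left_cancel_less) auto
  then show ?thesis using assms by (simp add: N_split[of x y z])
qed

text \<open>mu is carried by the zeros of f, where g vanishes. Cutting N down to the set where f is
  nonzero, by the density \<open>?h\<close>, therefore leaves only the Lebesgue part.\<close>

lemma nn_integral_N:
  assumes [measurable]: "g \<in> borel_measurable borel" and g: "\<And>y. f y = 0 \<Longrightarrow> g y = 0"
  shows "(\<integral>\<^sup>+y. g y \<partial>N) = (\<integral>\<^sup>+y. inv_fp f y * g y \<partial>lborel)"
proof -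
  let ?h = "\<lambda>y. indicator (f -` (- {0})) y :: ennreal"
  have [measurable]: "f -` (- {0}) \<in> sets borel"
    using measurable_sets_borel[OF f_meas] by simp
  have "density N ?h = density lborel (\<lambda>y. inv_fp f y * ?h y)"
  proof (rule measure_eqI)
    fix A assume "A \<in> sets (density N ?h)"
    then have [measurable]: "A \<in> sets borel" by simp
    have null: "emeasure \<mu> (A \<inter> f -` (- {0})) = 0"
    proof -
      have "f -` (- {0}) = UNIV - f -` {0}" by auto
      moreover from this have "UNIV - f -` {0} \<in> sets \<mu>"
        using \<open>f -` (- {0}) \<in> sets borel\<close> by (simp add: sets_mu)
      ultimately show ?thesis
        using emeasure_mono[of "A \<inter> f -` (- {0})" "UNIV - f -` {0}" \<mu>] supp by auto
    qed
    have "emeasure (density N ?h) A = emeasure N (A \<inter> f -` (- {0}))"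
      by (simp add: emeasure_density Int_commute flip: indicator_inter_arith)
    also have "\<dots> = emeasure (density lborel (inv_fp f)) (A \<inter> f -` (- {0}))"
      by (subst emeasure_N_density) (auto simp: null)
    also have "\<dots> = emeasure (density lborel (\<lambda>y. inv_fp f y * ?h y)) A"
      by (simp add: emeasure_density indicator_inter_arith ac_simps)
    finally show "emeasure (density N ?h) A = emeasure (density lborel (\<lambda>y. inv_fp f y * ?h y)) A" .
  qed simp
  then have "(\<integral>\<^sup>+y. g y \<partial>density N ?h) = (\<integral>\<^sup>+y. g y \<partial>density lborel (\<lambda>y. inv_fp f y * ?h y))"
    by simp
  then have "(\<integral>\<^sup>+y. ?h y * g y \<partial>N) = (\<integral>\<^sup>+y. inv_fp f y * ?h y * g y \<partial>lborel)"
    by (simp add: nn_integral_density)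
  moreover have "?h y * g y = g y" for y using g by (cases "f y = 0") auto
  ultimately show ?thesis by (simp add: mult.assoc)
qed

end

section \<open>Occupation measures\<close>

text \<open>Bridge from the gauge integral in \<open>caratheodory_sol\<close> to nonnegative
  integrals, where push-forward measures can be compared. Finiteness of both parts makes the
  subtraction meaningful.\<close>

lemma has_integral_pos_neg:
  fixes g :: "real \<Rightarrow> real" and a b :: real
  assumes [measurable]: "g \<in> borel_measurable borel" and K: "\<And>s. \<bar>g s\<bar> \<le> K"
  defines "I \<equiv> \<lambda>h. \<integral>\<^sup>+s. ennreal (h s) * indicator {a..b} s \<partial>lborel"
  shows "(g has_integral (enn2real (I g) - enn2real (I (\<lambda>s. - g s)))) {a..b}"
    and "I g < \<infinity>" and "I (\<lambda>s. - g s) < \<infinity>"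
proof -
  have int: "integrable lborel (\<lambda>s. indicator {a..b} s *\<^sub>R g s)"
    by (rule integrableI_bounded_set_indicator[where B=K])
       (use K in \<open>auto simp: emeasure_lborel_Icc_eq\<close>)
  have eq: "ennreal (indicator {a..b} s *\<^sub>R g s) = ennreal (g s) * indicator {a..b} s"
    "ennreal (- (indicator {a..b} s *\<^sub>R g s)) = ennreal (- g s) * indicator {a..b} s" for s
    by (auto split: split_indicator)
  have s: "set_integrable lborel {a..b} g"
    using int by (simp add: set_integrable_def)
  have "integral {a..b} g = enn2real (I g) - enn2real (I (\<lambda>s. - g s))"
    using set_borel_integral_eq_integral(2)[OF s] real_lebesgue_integral_def[OF int]
    unfolding set_lebesgue_integral_def I_def eq by simp
  then show "(g has_integral (enn2real (I g) - enn2real (I (\<lambda>s. - g s)))) {a..b}"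
    using set_borel_integral_eq_integral(1)[OF s] by (simp add: has_integral_integrable_integral)
  show "I g < \<infinity>" "I (\<lambda>s. - g s) < \<infinity>"
    using int unfolding real_integrable_def eq I_def by (auto simp: less_top)
qed

text \<open>Freezing the path outside [0,t] turns monotonicity or continuity on [0,t] into a global
  property, hence into Borel measurability on the whole line.\<close>

definition clamp_path :: "real \<Rightarrow> (real \<Rightarrow> real) \<Rightarrow> real \<Rightarrow> real" where
  "clamp_path t X s = X (max 0 (min t s))"

lemma clamp_path_eq: "0 \<le> s \<Longrightarrow> s \<le> t \<Longrightarrow> clamp_path t X s = X s"
  by (simp add: clamp_path_def)

lemma clamp_path_measurable:
  assumes "0 \<le> t" "strict_mono_on {0..t} X"
  shows "clamp_path t X \<in> borel_measurable borel"
proof (rule borel_measurable_mono, rule monoI)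
  fix r s :: real assume "r \<le> s"
  then show "clamp_path t X r \<le> clamp_path t X s"
    unfolding clamp_path_def
    by (intro strict_mono_on_leD[OF assms(2)]) (use assms(1) in auto)
qed

text \<open>The image of Lebesgue measure on [0,t] under the path: the mass of a set is the time
  that the path spends in it.\<close>

definition occupation :: "real \<Rightarrow> (real \<Rightarrow> real) \<Rightarrow> real measure" where
  "occupation t X = distr (density lborel (indicator {0..t})) borel (clamp_path t X)"

lemma sets_occupation [simp, measurable_cong]: "sets (occupation t X) = sets borel"
  by (simp add: occupation_def)

lemma emeasure_occupation:
  assumes cm [measurable]: "clamp_path t X \<in> borel_measurable borel" and [measurable]: "A \<in> sets borel"
  shows "emeasure (occupation t X) A = emeasure lborel {s\<in>{0..t}. X s \<in> A}"
proof -
  have "clamp_path t X -` A \<in> sets borel"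
    using measurable_sets[OF cm assms(2)] by simp
  then have "emeasure (occupation t X) A = emeasure lborel ({0..t} \<inter> clamp_path t X -` A)"
    by (simp add: occupation_def emeasure_distr emeasure_density indicator_inter_arith[symmetric])
  also have "{0..t} \<inter> clamp_path t X -` A = {s\<in>{0..t}. X s \<in> A}"
    by (auto simp: clamp_path_eq)
  finally show ?thesis .
qed

lemma nn_integral_occupation:
  assumes [measurable]: "clamp_path t X \<in> borel_measurable borel" "g \<in> borel_measurable borel"
  shows "(\<integral>\<^sup>+z. g z \<partial>occupation t X) = (\<integral>\<^sup>+s. g (clamp_path t X s) * indicator {0..t} s \<partial>lborel)"
  by (simp add: occupation_def nn_integral_distr nn_integral_density mult.commute)

context flow_data
begin

lemma time_inverse_has_integral:
  assumes t: "0 \<le> t"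
    and X: "\<And>s. 0 \<le> s \<Longrightarrow> s \<le> t \<Longrightarrow> x \<le> X s \<and> emeasure N {x..X s} = ennreal s"
  shows "((\<lambda>s. f (X s)) has_integral (X t - x)) {0..t}"
proof -
  have strict: "X r < X s" if "0 \<le> r" "r < s" "s \<le> t" for r s
  proof (rule ccontr)
    assume "\<not> X r < X s"
    then have "emeasure N {x..X s} \<le> emeasure N {x..X r}" by (intro emeasure_mono) auto
    then show False using X[of r] X[of s] that by auto
  qed
  then have mono: "strict_mono_on {0..t} X" by (auto intro!: strict_mono_onI)
  have cm [measurable]: "clamp_path t X \<in> borel_measurable borel" by (rule clamp_path_measurable[OF t mono])
  let ?y = "X t"
  have Xy: "X s \<le> ?y" if "0 \<le> s" "s \<le> t" for s
    using strict[of s t] that by (cases "s = t") auto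
  have xy: "x \<le> ?y" "emeasure N {x..?y} = ennreal t" using X[of t] t by auto
  have occ: "occupation t X = density N (indicator {x..?y})"
  proof (rule measure_eqI_lessThan)
    fix c
    have D: "emeasure (density N (indicator {x..?y})) {c<..} = emeasure N ({x..?y} \<inter> {c<..})"
      by (simp add: emeasure_density indicator_inter_arith[symmetric])
    have O: "emeasure (occupation t X) {c<..} = emeasure lborel {s\<in>{0..t}. c < X s}"
      by (subst emeasure_occupation[OF cm]) auto
    have "emeasure (occupation t X) {c<..} \<le> emeasure lborel {0..t}"
      unfolding O by (intro emeasure_mono) auto
    then show "emeasure (occupation t X) {c<..} < \<infinity>"
      using t by (auto simp: less_top[symmetric] top_unique)
    consider "c < x" | "x \<le> c" "c < ?y" | "?y \<le> c" by linarith
    then show "emeasure (occupation t X) {c<..} = emeasure (density N (indicator {x..?y})) {c<..}"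
    proof cases
      case 1
      then have "{s\<in>{0..t}. c < X s} = {0..t}" "{x..?y} \<inter> {c<..} = {x..?y}" using X by force+
      then show ?thesis using O D t xy by simp
    next
      case 2
      have "emeasure N {x..c} \<le> ennreal t"
        using 2 xy by (auto simp flip: xy(2) intro!: emeasure_mono)
      \<comment> \<open>The N-measure of [x,c] is the time a at which the path passes c, so that the
        path spends exactly t - a beyond c. That c itself is a value of X is not
        presupposed.\<close>
      then obtain a where a: "0 \<le> a" "a \<le> t" "emeasure N {x..c} = ennreal a"
        using t by (cases "emeasure N {x..c}") (auto simp: top_unique)
      have "c < X s \<longleftrightarrow> a < s" if s: "0 \<le> s" "s \<le> t" for s
      proof
        assume "c < X s"
        then have "emeasure N {x..c} < emeasure N {x..X s}" using 2 a by (intro N_strict) auto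
        then show "a < s" using X[OF s] a by (simp add: ennreal_less_iff)
      next
        assume "a < s"
        show "c < X s"
        proof (rule ccontr)
          assume "\<not> c < X s"
          then have "emeasure N {x..X s} \<le> emeasure N {x..c}" by (intro emeasure_mono) auto
          then show False using X[OF s] a \<open>a < s\<close> by simp
        qed
      qed
      then have "{s\<in>{0..t}. c < X s} = {a<..t}" using a by force
      then have o: "emeasure (occupation t X) {c<..} = ennreal (t - a)" using O a by simp
      have "{x..?y} = {x..c} \<union> ({x..?y} \<inter> {c<..})" using 2 by auto
      then have "emeasure N {x..?y} = emeasure N {x..c} + emeasure N ({x..?y} \<inter> {c<..})"
        by (metis (no_types, lifting) disjoint_iff greaterThan_iff atLeastAtMost_iff not_le IntE plus_emeasure sets_N
            borel_closed closed_real_atLeastAtMost sets.Int borel_open open_greaterThan)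
      then have "ennreal a + ennreal (t - a) = ennreal a + emeasure N ({x..?y} \<inter> {c<..})"
        using xy(2) a by (simp flip: ennreal_plus)
      then show ?thesis unfolding o D by (simp add: ennreal_add_left_cancel)
    next
      case 3
      then have "{s\<in>{0..t}. c < X s} = {}" "{x..?y} \<inter> {c<..} = {}" using Xy by force+
      then show ?thesis unfolding O D by (simp only: emeasure_empty)
    qed
  qed simp_all
  \<comment> \<open>Used with h the identity and h the negation, for the positive and the negative
    part of f. The condition at 0 is what removes mu.\<close>
  have key: "(\<integral>\<^sup>+s. ennreal (h (f (clamp_path t X s))) * indicator {0..t} s \<partial>lborel)
       = (\<integral>\<^sup>+z. inv_fp f z * (indicator {x..?y} z * ennreal (h (f z))) \<partial>lborel)"
    if [measurable]: "h \<in> borel_measurable borel" and "h 0 = 0" for h :: "real \<Rightarrow> real"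
  proof -
    have "(\<integral>\<^sup>+s. ennreal (h (f (clamp_path t X s))) * indicator {0..t} s \<partial>lborel)
        = (\<integral>\<^sup>+z. ennreal (h (f z)) \<partial>occupation t X)"
      by (subst nn_integral_occupation[OF cm]) auto
    also have "\<dots> = (\<integral>\<^sup>+z. indicator {x..?y} z * ennreal (h (f z)) \<partial>N)"
      unfolding occ by (subst nn_integral_density) auto
    also have "\<dots> = (\<integral>\<^sup>+z. inv_fp f z * (indicator {x..?y} z * ennreal (h (f z))) \<partial>lborel)"
      by (rule nn_integral_N) (auto simp: \<open>h 0 = 0\<close>)
    finally show ?thesis .
  qed
  \<comment> \<open>Almost everywhere on the interval f > 0, so \<open>inv_fp f z\<close> times f z
    is 1 and the positive part integrates to the length, while the negative part integrates to
    0.\<close>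
  have ae: "AE z in lborel. z \<in> {x..?y} \<longrightarrow> f z > 0" by (rule AE_pos) (simp add: xy)
  obtain K where K: "\<And>x. \<bar>f x\<bar> \<le> K" using A1_bound[OF A1] by blast
  have "(\<integral>\<^sup>+s. ennreal (f (clamp_path t X s)) * indicator {0..t} s \<partial>lborel)
      = (\<integral>\<^sup>+z. indicator {x..?y} z \<partial>lborel)"
    unfolding key[of "\<lambda>x. x", simplified]
    by (intro nn_integral_cong_AE, use ae in eventually_elim)
       (auto simp: inv_fp_def split: split_indicator simp flip: ennreal_mult ennreal_1)
  also have "\<dots> = ennreal (?y - x)" using xy by simp
  finally have p: "(\<integral>\<^sup>+s. ennreal (f (clamp_path t X s)) * indicator {0..t} s \<partial>lborel) = ennreal (?y - x)" .
  have "(\<integral>\<^sup>+s. ennreal (- f (clamp_path t X s)) * indicator {0..t} s \<partial>lborel) = (\<integral>\<^sup>+z. 0 \<partial>(lborel :: real measure))"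
    unfolding key[of "\<lambda>x. - x", simplified]
    by (intro nn_integral_cong_AE, use ae in eventually_elim) (auto split: split_indicator simp: ennreal_neg)
  then have n: "(\<integral>\<^sup>+s. ennreal (- f (clamp_path t X s)) * indicator {0..t} s \<partial>lborel) = 0" by simp
  have "((\<lambda>s. f (clamp_path t X s)) has_integral (?y - x)) {0..t}"
    using has_integral_pos_neg(1)[of "\<lambda>s. f (clamp_path t X s)" K 0 t] K xy(1) unfolding p n by simp
  then show ?thesis
    by (rule has_integral_eq[rotated]) (simp add: clamp_path_eq)
qed

end

section \<open>The travel time of a given increasing solution\<close>

text \<open>Let M be the occupation measure, and let p and n be M weighted by the positive and the
  negative part of f. The integral equation between a crossing time and q says that p - n is
  Lebesgue measure L on [X 0, X q], tested on half-lines. As p and n live on disjoint sets, n and L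
  vanish on f <= 0, and p = L on f > 0. Dividing by f gives the time spent in f > 0 as the integral
  of 1/f; the remaining time is spent in zeros of f.\<close>

lemma solution_time:
  assumes f: "A1 f" and q: "0 \<le> q" and mono: "strict_mono_on {0..q} X" and cont: "continuous_on {0..q} X"
    and sol: "\<And>t. 0 \<le> t \<Longrightarrow> t \<le> q \<Longrightarrow> ((\<lambda>s. f (X s)) has_integral (X t - X 0)) {0..t}"
  shows "emeasure lborel {t\<in>{0..q}. f (X t) = 0} + int_on {X 0..X q} (inv_fp f) = ennreal q"
proof -
  note [measurable] = A1_measurable[OF f] clamp_path_measurable[OF q mono]
  note cm = clamp_path_measurable[OF q mono]
  let ?M = "occupation q X"
  have sM [simp]: "sets ?M = sets borel" by simp
  obtain K where K: "\<And>x. \<bar>f x\<bar> \<le> K" using A1_bound[OF f] by blast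
  define p where "p = density ?M (\<lambda>z. ennreal (f z))"
  define n where "n = density ?M (\<lambda>z. ennreal (- f z))"
  define L where "L = density lborel (indicator {X 0..X q} :: real \<Rightarrow> ennreal)"
  have sets [simp, measurable_cong]: "sets p = sets borel" "sets n = sets borel" "sets L = sets borel"
    by (simp_all add: p_def n_def L_def)
  obtain Q where Q: "sets Q = sets borel" "\<And>A. A \<in> sets borel \<Longrightarrow> emeasure Q A = emeasure n A + emeasure L A"
    using ex_sum_measure[of n L] by auto
  have dens: "emeasure (density ?M (\<lambda>z. ennreal (h z))) A
      = (\<integral>\<^sup>+s. ennreal (h (clamp_path q X s)) * indicator A (clamp_path q X s) * indicator {0..q} s \<partial>lborel)"
    if [measurable]: "h \<in> borel_measurable borel" "A \<in> sets borel" for h :: "real \<Rightarrow> real" and A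
    by (subst emeasure_density, simp_all add: measurable_cong_sets[OF sM refl], subst nn_integral_occupation[OF cm]) auto
  have less: "X r < X s" if "0 \<le> r" "r < s" "s \<le> q" for r s
    using strict_mono_onD[OF mono, of r s] that by auto
  have le: "X r \<le> X s" if "0 \<le> r" "r \<le> s" "s \<le> q" for r s
    using less[of r s] that by (cases "r = s") auto
  have X0q: "X 0 \<le> X q" using le[of 0 q] q by simp
  have half: "emeasure p {c<..} = emeasure n {c<..} + emeasure L {c<..} \<and> emeasure p {c<..} < \<infinity>" for c
  proof (cases "c < X q")
    case False
    have z: "clamp_path q X s \<notin> {c<..}" for s
      unfolding clamp_path_def using le[of "max 0 (min q s)" q] False q by auto
    have "emeasure p {c<..} = 0" "emeasure n {c<..} = 0"
      unfolding p_def n_def using dens[of f "{c<..}"] dens[of "\<lambda>z. - f z" "{c<..}"] z by simp_all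
    moreover have "{X 0..X q} \<inter> {c<..} = {}" using False by auto
    then have "emeasure L {c<..} = 0"
      by (simp add: L_def emeasure_density indicator_inter_arith[symmetric])
    ultimately show ?thesis by simp
  next
    case True
    \<comment> \<open>The time at which the path crosses c; the maximum with X 0 covers levels c
      below the starting point, where the whole interval [0,q] counts.\<close>
    obtain a where a: "0 \<le> a" "a \<le> q" "X a = max c (X 0)"
      using IVT'[of X 0 "max c (X 0)" q] True X0q q cont by auto
    have ae: "AE s in lborel. indicator {c<..} (clamp_path q X s) * indicator {0..q} s = (indicator {a..q} s :: ennreal)"
      using AE_lborel_singleton[of a]
    proof eventually_elim
      case (elim s)
      have "c < X s \<longleftrightarrow> a < s" if "0 \<le> s" "s \<le> q"
      proof (cases "a < s")
        case True
        then show ?thesis using less[of a s] a that by auto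
      next
        case False
        then have "s < a" using elim by auto
        then show ?thesis using less[of s a] le[of 0 s] a that by auto
      qed
      then show ?case using elim a by (auto split: split_indicator simp: clamp_path_eq)
    qed
    have half_int: "emeasure (density ?M (\<lambda>z. ennreal (h z))) {c<..}
        = (\<integral>\<^sup>+s. ennreal (h (clamp_path q X s)) * indicator {a..q} s \<partial>lborel)"
      if [measurable]: "h \<in> borel_measurable borel" for h :: "real \<Rightarrow> real"
      unfolding dens[OF that borel_open[OF open_greaterThan]]
      by (intro nn_integral_cong_AE, use ae in eventually_elim) (metis mult.assoc)
    let ?g = "\<lambda>s. f (clamp_path q X s)"
    have gm: "?g \<in> borel_measurable borel" by measurable
    note pn = has_integral_pos_neg[of ?g K a q, OF gm K]
    have P: "emeasure p {c<..} = (\<integral>\<^sup>+s. ennreal (?g s) * indicator {a..q} s \<partial>lborel)"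
      unfolding p_def by (rule half_int) simp
    have n: "emeasure n {c<..} = (\<integral>\<^sup>+s. ennreal (- ?g s) * indicator {a..q} s \<partial>lborel)"
      unfolding n_def by (rule half_int[of "\<lambda>z. - f z"]) simp
    have "((\<lambda>s. f (X s)) has_integral (X q - X a)) {a..q}"
    proof -
      have "((\<lambda>s. f (X s)) has_integral (X q - X 0)) {0..q}" "((\<lambda>s. f (X s)) has_integral (X a - X 0)) {0..a}"
        using sol[of q] sol[of a] a(1,2) q by blast+
      note full = this
      have "(\<lambda>s. f (X s)) integrable_on {0..q}" using full(1) by blast
      then have "(\<lambda>s. f (X s)) integrable_on {a..q}"
        by (rule integrable_on_subinterval) (use a in auto)
      then have i: "((\<lambda>s. f (X s)) has_integral integral {a..q} (\<lambda>s. f (X s))) {a..q}"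
        by (rule integrable_integral)
      from has_integral_combine[OF a(1,2) full(2) this]
      have "X a - X 0 + integral {a..q} (\<lambda>s. f (X s)) = X q - X 0"
        using full(1) by (rule has_integral_unique)
      then have "integral {a..q} (\<lambda>s. f (X s)) = X q - X a" by simp
      with i show ?thesis by simp
    qed
    then have "(?g has_integral (X q - X a)) {a..q}"
      by (rule has_integral_eq[rotated]) (use a in \<open>simp add: clamp_path_eq\<close>)
    from has_integral_unique[OF pn(1) this]
    have eq: "enn2real (emeasure p {c<..}) - enn2real (emeasure n {c<..}) = X q - X a"
      using P n by simp
    have fin: "emeasure p {c<..} < \<infinity>" "emeasure n {c<..} < \<infinity>" using P n pn by auto
    have "{X 0..X q} \<inter> {c<..} = (if c < X 0 then {X a..X q} else {X a<..X q})" using a by auto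
    then have "emeasure L {c<..} = ennreal (X q - X a)"
      using le[of a q] a by (simp add: L_def emeasure_density indicator_inter_arith[symmetric])
    moreover have "emeasure p {c<..} = ennreal (enn2real (emeasure n {c<..}) + (X q - X a))"
    proof -
      have "enn2real (emeasure p {c<..}) = enn2real (emeasure n {c<..}) + (X q - X a)" using eq by simp
      then show ?thesis using fin(1) by (metis ennreal_enn2real infinity_ennreal_def)
    qed
    then have "emeasure p {c<..} = emeasure n {c<..} + ennreal (X q - X a)"
      using fin le[of a q] a by (simp add: ennreal_plus less_top[symmetric])
    ultimately show ?thesis using fin by simp
  qed
  \<comment> \<open>The measures p and n + L agree and are finite on all half-lines
    \<open>{c<..}\<close>, which determines them. Writing the relation as a sum avoids a signed
    measure.\<close>
  have "p = Q"
  proof (rule measure_eqI_lessThan)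
    fix c
    show "emeasure p {c<..} < \<infinity>" using half by blast
    show "emeasure p {c<..} = emeasure Q {c<..}" using half Q(2)[of "{c<..}"] by simp
  qed (simp_all add: Q)
  then have pQ: "emeasure p A = emeasure n A + emeasure L A" if "A \<in> sets borel" for A
    using Q that by simp
  \<comment> \<open>On this set the weight of p is zero, so p = n + L kills both n and L there: the
    path spends almost no time where f < 0, and f > 0 almost everywhere on [X 0, X q].\<close>
  let ?neg = "{z. f z \<le> 0}"
  have ns [measurable]: "?neg \<in> sets borel" "{z. 0 < f z} \<in> sets borel" "{z. f z < 0} \<in> sets borel" "{z. f z = 0} \<in> sets borel"
    by measurable
  have fM: "(\<lambda>z. ennreal (f z)) \<in> borel_measurable ?M" "(\<lambda>z. ennreal (- f z)) \<in> borel_measurable ?M"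
    by (simp_all add: measurable_cong_sets[OF sM refl])
  have "(\<lambda>z. ennreal (f z) * indicator ?neg z) = (\<lambda>z. 0)"
    by (auto simp: ennreal_neg split: split_indicator)
  then have "emeasure p ?neg = 0"
    unfolding p_def by (subst emeasure_density) (auto simp: fM)
  then have zero: "emeasure n ?neg = 0" "emeasure L ?neg = 0"
    using pQ[of ?neg] by simp_all
  have "emeasure n ?neg = (\<integral>\<^sup>+z. ennreal (- f z) * indicator ?neg z \<partial>?M)"
    unfolding n_def by (subst emeasure_density, fact fM) auto
  then have "AE z in ?M. ennreal (- f z) * indicator ?neg z = 0"
    using zero(1) fM by (subst (asm) (2) eq_commute, subst nn_integral_0_iff_AE[symmetric]) (auto simp: measurable_cong_sets[OF sM refl])
  then have "AE z in ?M. \<not> f z < 0" by eventually_elim (auto simp: ennreal_eq_0_iff)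
  then have Mneg: "emeasure ?M {z. f z < 0} = 0"
    using AE_iff_measurable[of "{z. f z < 0}" ?M "\<lambda>z. \<not> f z < 0"] sets_eq_imp_space_eq[OF sM] by auto
  have "AE z in lborel. z \<in> {X 0..X q} \<longrightarrow> 0 < f z"
  proof -
    have "emeasure lborel ({X 0..X q} \<inter> ?neg) = 0"
      using zero(2) by (simp add: L_def emeasure_density indicator_inter_arith[symmetric])
    then show ?thesis
      by (subst AE_iff_measurable[of "{X 0..X q} \<inter> ?neg"]) auto
  qed
  then have int: "int_on {X 0..X q} (inv_fp f) = (\<integral>\<^sup>+z. indicator {z. 0 < f z} z * inv_fp f z \<partial>L)"
    unfolding int_on_def L_def
    by (subst nn_integral_density) (auto intro!: nn_integral_cong_AE split: split_indicator)
  \<comment> \<open>Where f > 0 the measure n has weight zero, so only p = L remains; integrating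
    \<open>inv_fp f\<close> against both sides cancels the weight f in p.\<close>
  have "density p (indicator {z. 0 < f z}) = density L (indicator {z. 0 < f z})"
  proof (rule measure_eqI)
    fix A assume "A \<in> sets (density p (indicator {z. 0 < f z}))"
    then have [measurable]: "A \<in> sets borel" by simp
    have "(\<lambda>z. ennreal (- f z) * indicator ({z. 0 < f z} \<inter> A) z) = (\<lambda>z. 0)"
      by (auto simp: ennreal_neg split: split_indicator)
    then have "emeasure n ({z. 0 < f z} \<inter> A) = 0"
      unfolding n_def by (subst emeasure_density) (auto simp: fM)
    then show "emeasure (density p (indicator {z. 0 < f z})) A = emeasure (density L (indicator {z. 0 < f z})) A"
      using pQ[of "{z. 0 < f z} \<inter> A"]
      by (simp add: emeasure_density indicator_inter_arith[symmetric] measurable_cong_sets[OF sets(1) refl] measurable_cong_sets[OF sets(3) refl])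
  qed simp
  then have "(\<integral>\<^sup>+z. inv_fp f z \<partial>density p (indicator {z. 0 < f z})) = (\<integral>\<^sup>+z. inv_fp f z \<partial>density L (indicator {z. 0 < f z}))"
    by simp
  then have "(\<integral>\<^sup>+z. indicator {z. 0 < f z} z * inv_fp f z \<partial>p) = (\<integral>\<^sup>+z. indicator {z. 0 < f z} z * inv_fp f z \<partial>L)"
    by (subst (asm) (1 2) nn_integral_density) (simp_all add: measurable_cong_sets[OF sets(1) refl] measurable_cong_sets[OF sets(3) refl])
  also have "(\<integral>\<^sup>+z. indicator {z. 0 < f z} z * inv_fp f z \<partial>p)
      = (\<integral>\<^sup>+z. ennreal (f z) * (indicator {z. 0 < f z} z * inv_fp f z) \<partial>?M)"
    unfolding p_def by (subst nn_integral_density) (auto simp: measurable_cong_sets[OF sM refl])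
  also have "\<dots> = (\<integral>\<^sup>+z. indicator {z. 0 < f z} z \<partial>?M)"
    by (intro nn_integral_cong)
       (auto simp: inv_fp_def split: split_indicator simp flip: ennreal_mult ennreal_1)
  also have "\<dots> = emeasure ?M {z. 0 < f z}" by (subst nn_integral_indicator) auto
  finally have pos: "emeasure ?M {z. 0 < f z} = int_on {X 0..X q} (inv_fp f)" by (simp add: int)
  have "emeasure ?M UNIV = emeasure lborel {0..q}"
    by (subst emeasure_occupation[OF cm]) (auto intro: arg_cong[of _ _ "emeasure lborel"])
  moreover have "emeasure ?M {z. f z = 0} + emeasure ?M {z. 0 < f z} + emeasure ?M {z. f z < 0} = emeasure ?M UNIV"
  proof -
    have "emeasure ?M {z. f z = 0} + emeasure ?M {z. 0 < f z} = emeasure ?M ({z. f z = 0} \<union> {z. 0 < f z})"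
      by (rule plus_emeasure) auto
    moreover have "\<dots> + emeasure ?M {z. f z < 0} = emeasure ?M ({z. f z = 0} \<union> {z. 0 < f z} \<union> {z. f z < 0})"
      by (rule plus_emeasure) auto
    moreover have "{z. f z = 0} \<union> {z. 0 < f z} \<union> {z. f z < 0} = UNIV" by auto
    ultimately show ?thesis by simp
  qed
  moreover have "emeasure ?M {z. f z = 0} = emeasure lborel {t\<in>{0..q}. f (X t) = 0}"
    by (subst emeasure_occupation[OF cm]) auto
  ultimately show ?thesis using pos Mneg q by simp
qed

section \<open>Passable intervals and domains of increase\<close>

context flow_data
begin

definition passable :: "real \<Rightarrow> real \<Rightarrow> bool" where
  "passable x y \<longleftrightarrow> x \<le> y \<and> {x..y} \<inter> Sg = {} \<and> emeasure N {x..y} < \<infinity>"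

lemma passable_trans:
  assumes "passable x y" "passable y z"
  shows "passable x z"
proof -
  have "{x..z} = {x..y} \<union> {y..z}" using assms unfolding passable_def by auto
  then have "{x..z} \<inter> Sg = {}" using assms unfolding passable_def by blast
  then show ?thesis using assms by (auto simp: passable_def N_split[of x y z])
qed

lemma passable_left: "passable x z \<Longrightarrow> x \<le> y \<Longrightarrow> y \<le> z \<Longrightarrow> passable x y"
  and passable_right: "passable x z \<Longrightarrow> x \<le> y \<Longrightarrow> y \<le> z \<Longrightarrow> passable y z"
  unfolding passable_def disjoint_iff by (auto simp: N_split[of x y z])

lemma dom_inc_iff:
  "dom_inc f \<mu> Sg D \<longleftrightarrow> open_interval D \<and> (\<forall>c d. c \<le> d \<longrightarrow> {c..d} \<subseteq> D \<longrightarrow> passable c d)"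
proof
  assume "dom_inc f \<mu> Sg D"
  then show "open_interval D \<and> (\<forall>c d. c \<le> d \<longrightarrow> {c..d} \<subseteq> D \<longrightarrow> passable c d)"
    unfolding dom_inc_def passable_def by (auto simp: emeasure_N)
next
  assume D: "open_interval D \<and> (\<forall>c d. c \<le> d \<longrightarrow> {c..d} \<subseteq> D \<longrightarrow> passable c d)"
  \<comment> \<open>Degenerate intervals recover that D avoids Sg.\<close>
  then have "passable x x" if "x \<in> D" for x using that by auto
  then have "D \<inter> Sg = {}" unfolding passable_def by auto
  moreover have "emeasure N {c..d} < \<infinity>" if "{c..d} \<subseteq> D" for c d
    using D that by (cases "c \<le> d") (auto simp: passable_def)
  ultimately show "dom_inc f \<mu> Sg D" using D unfolding dom_inc_def by (simp add: emeasure_N)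
qed

text \<open>An interval [c,d] in the union needs only two members, one containing c and one
  containing d. Both contain p, so [c,d] is handled by joining at p, or by cutting off if p lies
  outside it. No compactness argument is needed.\<close>

lemma dom_inc_Union:
  assumes C: "\<And>D. D \<in> C \<Longrightarrow> dom_inc f \<mu> Sg D \<and> p \<in> D" and "C \<noteq> {}"
  shows "dom_inc f \<mu> Sg (\<Union>C)"
  unfolding dom_inc_iff
proof (intro conjI allI impI)
  have D: "open D" "connected D" "p \<in> D" if "D \<in> C" for D
    using C[OF that] by (simp_all add: dom_inc_iff open_interval_def is_interval_connected_1)
  have "p \<in> \<Inter>C" using D(3) by (rule InterI)
  then have "connected (\<Union>C)"
    using D(2) by (intro connected_Union) auto
  moreover have "open (\<Union>C)" using D by blast
  moreover have "\<Union>C \<noteq> {}" using D(3) \<open>C \<noteq> {}\<close> by blast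
  ultimately show "open_interval (\<Union>C)"
    unfolding open_interval_def is_interval_connected_1 by blast
  fix c d :: real assume cd: "c \<le> d" "{c..d} \<subseteq> \<Union>C"
  have "c \<in> {c..d}" "d \<in> {c..d}" using cd(1) by simp_all
  then have "c \<in> \<Union>C" "d \<in> \<Union>C" using subsetD[OF cd(2)] by blast+
  then obtain A B where AB: "A \<in> C" "c \<in> A" "B \<in> C" "d \<in> B" unfolding Union_iff by blast
  have pass: "passable u v" if "D \<in> C" "u \<in> D" "v \<in> D" "u \<le> v" for D u v
  proof -
    have "is_interval D" using D[OF that(1)] by (simp add: is_interval_connected_1)
    then have "{u..v} \<subseteq> D" using mem_is_interval_1_I[OF _ that(2,3)] by auto
    then show ?thesis using C[OF that(1)] that(4) by (simp add: dom_inc_iff)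
  qed
  have p: "p \<in> A" "p \<in> B" using D AB by blast+
  consider "p \<le> c" | "d \<le> p" | "c \<le> p" "p \<le> d" by linarith
  then show "passable c d"
  proof cases
    case 1
    then have "passable p d" using pass[OF AB(3) p(2) AB(4)] cd(1) by simp
    then show ?thesis using 1 cd(1) by (rule passable_right)
  next
    case 2
    then have "passable c p" using pass[OF AB(1,2) p(1)] cd(1) by simp
    then show ?thesis using cd(1) 2 by (rule passable_left)
  next
    case 3
    show ?thesis
      using pass[OF AB(1,2) p(1) 3(1)] pass[OF AB(3) p(2) AB(4) 3(2)] by (rule passable_trans)
  qed
qed

lemma dom_inc_Ioo:
  assumes "passable x y" "x < y"
  shows "dom_inc f \<mu> Sg {x<..<y}"
  unfolding dom_inc_iff
proof (intro conjI allI impI)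
  show "open_interval {x<..<y}"
    unfolding open_interval_def using assms dense[of x y] by (auto simp: is_interval_oo)
  fix c d assume "c \<le> d" "{c..d} \<subseteq> {x<..<y}"
  then have "x < c" "d < y" by auto
  then show "passable c d"
    using passable_left[of c y d] passable_right[of x y c] assms \<open>c \<le> d\<close> by auto
qed

lemma I_plus_passable:
  assumes "max_dom_inc f \<mu> Sg D" "x \<in> I_plus f \<mu> Sg D"
  shows "z \<in> D \<Longrightarrow> x \<le> z \<Longrightarrow> passable x z" and "\<exists>z\<in>D. x < z" and "z \<in> D \<Longrightarrow> z < x \<Longrightarrow> x \<in> D"
proof -
  have D: "dom_inc f \<mu> Sg D" using assms by (simp add: max_dom_inc_def)
  then have o: "open D" "is_interval D" "D \<noteq> {}" by (auto simp: dom_inc_iff open_interval_def)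
  have sub: "passable c d" if "c \<in> D" "d \<in> D" "c \<le> d" for c d
  proof -
    have "{c..d} \<subseteq> D" using mem_is_interval_1_I[OF o(2) that(1,2)] by auto
    then show ?thesis using D that(3) by (simp add: dom_inc_iff)
  qed
  consider "x \<in> D" | "x \<notin> D" "bdd_below D" "x = Inf D" "x \<notin> Sg"
    "\<exists>\<epsilon>>0. emeasure N {x..x+\<epsilon>} < \<infinity>"
    using assms(2) unfolding I_plus_def by (auto simp: emeasure_N)
  then have "(z \<in> D \<longrightarrow> x \<le> z \<longrightarrow> passable x z) \<and> (\<exists>z\<in>D. x < z) \<and> (z \<in> D \<longrightarrow> z < x \<longrightarrow> x \<in> D)"
  proof cases
    case 1
    obtain e where "e > 0" "cball x e \<subseteq> D" using o(1) 1 open_contains_cball by blast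
    then have "x + e \<in> D" by (auto simp: dist_real_def)
    then show ?thesis using sub 1 \<open>e > 0\<close> by (auto intro!: bexI[of _ "x+e"])
  next
    case 2
    then have gt: "x < z" if "z \<in> D" for z
      using that cInf_lower[of z D] by (cases "x = z") auto
    have "passable x z" if z: "z \<in> D" for z
    proof -
      obtain \<epsilon> where e: "\<epsilon> > 0" "emeasure N {x..x+\<epsilon>} < \<infinity>" using 2 by blast
      have "x < min z (x + \<epsilon>)" using gt z e by auto
      \<comment> \<open>w must lie in D, within the epsilon of the endpoint condition, and before
        z.\<close>
      then obtain w where w: "w \<in> D" "w < min z (x + \<epsilon>)"
        using cInf_lessD[of D "min z (x+\<epsilon>)"] o 2 by auto
      have "{x..w} \<inter> Sg = {}"
      proof -
        have "u \<notin> Sg" if "x \<le> u" "u \<le> w" for u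
        proof (cases "u = x")
          case False
          then have "x < u" using that by simp
          then obtain v where "v \<in> D" "v < u" using cInf_lessD[of D u] o 2 by auto
          then have "passable v w" using sub[of v w] w that by auto
          then show ?thesis using \<open>v < u\<close> that by (auto simp: passable_def disjoint_iff)
        qed (use 2 in simp)
        then show ?thesis by auto
      qed
      moreover have "emeasure N {x..w} \<le> emeasure N {x..x+\<epsilon>}" using w by (intro emeasure_mono) auto
      ultimately have "passable x w"
        using e(2) gt[OF w(1)] by (auto simp: passable_def dest: le_less_trans)
      moreover have "passable w z" using sub[OF w(1) z] w(2) by simp
      ultimately show ?thesis by (rule passable_trans)
    qed
    moreover obtain z where "z \<in> D" using o(3) by blast
    ultimately show ?thesis using gt by (meson less_asym)
  qed
  then show "z \<in> D \<Longrightarrow> x \<le> z \<Longrightarrow> passable x z" and "\<exists>z\<in>D. x < z" and "z \<in> D \<Longrightarrow> z < x \<Longrightarrow> x \<in> D"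
    by auto
qed

lemma U_plus_iff: "x \<in> U_plus f \<mu> Sg \<longleftrightarrow> (\<exists>y>x. passable x y)"
proof
  assume "x \<in> U_plus f \<mu> Sg"
  then obtain D where D: "max_dom_inc f \<mu> Sg D" "x \<in> I_plus f \<mu> Sg D" by (auto simp: U_plus_def)
  obtain z where "z \<in> D" "x < z" using I_plus_passable(2)[OF D] by blast
  then show "\<exists>y>x. passable x y" using I_plus_passable(1)[OF D, of z] by auto
next
  assume "\<exists>y>x. passable x y"
  then obtain y where y: "x < y" "passable x y" by auto
  \<comment> \<open>All members share the midpoint of ]x,y[, so their union is again a
    domain.\<close>
  define C where "C = {D. dom_inc f \<mu> Sg D \<and> {x<..<y} \<subseteq> D}"
  have i: "{x<..<y} \<in> C" using dom_inc_Ioo[OF y(2,1)] by (simp add: C_def)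
  have p: "(x + y) / 2 \<in> {x<..<y}" using y by auto
  have D: "dom_inc f \<mu> Sg (\<Union>C)"
  proof (rule dom_inc_Union[of _ "(x+y)/2"])
    fix E assume "E \<in> C"
    then show "dom_inc f \<mu> Sg E \<and> (x+y)/2 \<in> E" using subsetD[OF _ p] by (simp add: C_def)
  qed (use i in blast)
  have "max_dom_inc f \<mu> Sg (\<Union>C)"
    unfolding max_dom_inc_def
  proof (intro conjI allI impI D)
    fix D' assume D': "dom_inc f \<mu> Sg D' \<and> \<Union>C \<subseteq> D'"
    then have "D' \<in> C" using i unfolding C_def by blast
    then show "D' = \<Union>C" using D' by blast
  qed
  moreover have "x \<in> I_plus f \<mu> Sg (\<Union>C)"
  proof (cases "x \<in> \<Union>C")
    case True
    then show ?thesis by (auto simp: I_plus_def)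
  next
    case False
    have sub: "{x<..<y} \<subseteq> \<Union>C" using i by (rule Union_upper)
    have int: "is_interval (\<Union>C)" using D by (simp add: dom_inc_iff open_interval_def)
    have gt: "x \<le> d" if "d \<in> \<Union>C" for d
    proof (rule ccontr)
      assume "\<not> x \<le> d"
      then have "d \<le> x" "x \<le> (x+y)/2" using y(1) by simp_all
      with mem_is_interval_1_I[OF int that subsetD[OF sub p]] have "x \<in> \<Union>C" by blast
      then show False using False by blast
    qed
    have "Inf (\<Union>C) = x"
    proof (rule cInf_eq)
      fix l assume l: "\<And>z. z \<in> \<Union>C \<Longrightarrow> l \<le> z"
      show "l \<le> x"
      proof (rule field_le_epsilon)
        fix e :: real assume "e > 0"
        then have "x + min e ((y - x)/2) \<in> {x<..<y}" using y(1) by (auto simp: min_def field_simps)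
        then have "x + min e ((y - x)/2) \<in> \<Union>C" by (rule subsetD[OF sub])
        from l[OF this] show "l \<le> x + e" by auto
      qed
    qed (rule gt)
    moreover have "bdd_below (\<Union>C)" using gt by (rule bdd_belowI)
    moreover have "x \<notin> Sg" using y by (auto simp: passable_def disjoint_iff)
    moreover have "\<exists>\<epsilon>>0. emeasure \<mu> {x..x + \<epsilon>} + int_on {x..x + \<epsilon>} (inv_fp f) < \<infinity>"
    proof (intro exI conjI)
      show "0 < y - x" using y(1) by simp
      show "emeasure \<mu> {x..x + (y - x)} + int_on {x..x + (y - x)} (inv_fp f) < \<infinity>"
        using y(2) by (simp add: passable_def emeasure_N)
    qed
    ultimately show ?thesis unfolding I_plus_def by simp
  qed
  ultimately show "x \<in> U_plus f \<mu> Sg" unfolding U_plus_def by blast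
qed

text \<open>For x in \<open>I_plus\<close> this is the right endpoint beta of the maximal domain,
  expressed without the domain. It is extended real because beta may be infinite.\<close>

definition reach :: "real \<Rightarrow> ereal" where
  "reach x = Sup (ereal ` {y. passable x y})"

text \<open>A point z passable from x but beyond D would let D be enlarged by ]x,z[, against
  maximality.\<close>

lemma Sup_max_dom_inc:
  assumes D: "max_dom_inc f \<mu> Sg D" "x \<in> I_plus f \<mu> Sg D"
  shows "Sup (ereal ` D) = reach x"
proof (rule antisym)
  show "Sup (ereal ` D) \<le> reach x"
    unfolding reach_def
  proof (rule Sup_mono)
    fix a assume "a \<in> ereal ` D"
    then obtain d where d: "d \<in> D" "a = ereal d" by auto
    \<comment> \<open>D may extend to the left of x; such points are replaced by x itself.\<close>
    have "passable x (max d x)"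
    proof (cases "x \<le> d")
      case True
      then show ?thesis using I_plus_passable(1)[OF D d(1)] by (simp add: max_def)
    next
      case False
      then show ?thesis using I_plus_passable(1)[OF D I_plus_passable(3)[OF D d(1)]] by (simp add: max_def)
    qed
    then show "\<exists>b\<in>ereal ` {y. passable x y}. a \<le> b" using d by (auto intro!: exI[of _ "max d x"])
  qed
  show "reach x \<le> Sup (ereal ` D)"
    unfolding reach_def
  proof (rule Sup_least, safe)
    fix z assume z: "passable x z"
    obtain w where w: "w \<in> D" "x < w" using I_plus_passable(2)[OF D] by auto
    show "ereal z \<le> Sup (ereal ` D)"
    proof (rule ccontr)
      assume "\<not> ereal z \<le> Sup (ereal ` D)"
      then have lt: "d < z" if "d \<in> D" for d
      proof -
        have "ereal d \<le> Sup (ereal ` D)" using that by (rule SUP_upper)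
        also have "\<dots> < ereal z" using \<open>\<not> ereal z \<le> Sup (ereal ` D)\<close> by simp
        finally show ?thesis by simp
      qed
      have xz: "x < z" using lt[OF w(1)] w by simp
      \<comment> \<open>The two domains overlap at w. Maximality then puts ]x,z[ inside D, so the
        supremum of D is at least z after all.\<close>
      have "dom_inc f \<mu> Sg (\<Union>{D, {x<..<z}})"
      proof (rule dom_inc_Union[of _ w])
        fix E assume "E \<in> {D, {x<..<z}}"
        then consider "E = D" | "E = {x<..<z}" by blast
        then show "dom_inc f \<mu> Sg E \<and> w \<in> E"
        proof cases
          case 1
          then show ?thesis using D(1) w(1) by (simp add: max_dom_inc_def)
        next
          case 2
          then show ?thesis using dom_inc_Ioo[OF z xz] lt[OF w(1)] w(2) by simp
        qed
      qed simp
      then have "\<Union>{D, {x<..<z}} = D"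
        using conjunct2[OF D(1)[unfolded max_dom_inc_def], rule_format, of "\<Union>{D, {x<..<z}}"] by blast
      then have sub: "{x<..<z} \<subseteq> D" by auto
      have below: "ereal u \<le> Sup (ereal ` D)" if "u < z" for u
      proof -
        have "(max u x + z) / 2 \<in> D" using sub that xz by (auto simp: max_def)
        then have "ereal ((max u x + z) / 2) \<le> Sup (ereal ` D)" by (rule SUP_upper)
        moreover have "u \<le> (max u x + z) / 2" using that xz by (auto simp: max_def)
        ultimately show ?thesis by (auto intro: order_trans[of _ "ereal ((max u x + z) / 2)"])
      qed
      have "ereal z \<le> Sup (ereal ` D)"
      proof (rule dense_le)
        fix a assume "a < ereal z"
        then show "a \<le> Sup (ereal ` D)" using below by (cases a) auto
      qed
      with \<open>\<not> ereal z \<le> Sup (ereal ` D)\<close> show False by simp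
    qed
  qed
qed

definition travel_time :: "real \<Rightarrow> ennreal" where
  "travel_time x = emeasure N {y. x \<le> y \<and> ereal y \<le> reach x}"

text \<open>\<open>S_plus\<close> with the domain replaced by \<open>reach x\<close>;
  \<open>S_plus_eq\<close> identifies the two.\<close>

definition flow_right :: "real \<Rightarrow> real \<Rightarrow> real" where
  "flow_right x t = (if ennreal t < travel_time x
     then (THE y. x \<le> y \<and> ereal y < reach x \<and> emeasure N {x..y} = ennreal t)
     else real_of_ereal (reach x))"

lemma S_plus_eq:
  assumes "max_dom_inc f \<mu> Sg D" "x \<in> I_plus f \<mu> Sg D"
  shows "S_plus f \<mu> D x t = flow_right x t"
proof -
  have "{y. x \<le> y \<and> ereal y \<le> reach x} \<in> sets borel" by measurable
  from emeasure_N[OF this] show ?thesis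
    unfolding S_plus_def Let_def Sup_max_dom_inc[OF assms] flow_right_def travel_time_def
    by (simp add: emeasure_N)
qed

lemma passable_below_reach:
  assumes "x \<le> z" "ereal z < reach x"
  shows "passable x z"
proof -
  from assms(2) obtain y where "passable x y" "z < y" unfolding reach_def by (auto simp: less_SUP_iff)
  then show ?thesis using passable_left assms by auto
qed

lemma passable_le_reach: "passable x z \<Longrightarrow> ereal z \<le> reach x"
  unfolding reach_def by (auto intro: SUP_upper)

text \<open>The endpoint \<open>reach x\<close> carries no mass, so by continuity from below the
  travel time is the supremum of the N-measures of [x,z] with z before the endpoint. This treats
  finite and infinite endpoints alike.\<close>

lemma travel_time_gt:
  assumes "\<exists>y>x. passable x y"
  shows "c < travel_time x \<longleftrightarrow> (\<exists>z\<ge>x. ereal z < reach x \<and> c < emeasure N {x..z})"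
proof
  have xr: "ereal x < reach x" 
  proof -
    obtain y where "x < y" "passable x y" using assms by auto
    then have "ereal x < ereal y" "ereal y \<le> reach x" using passable_le_reach by auto
    then show ?thesis by (rule less_le_trans)
  qed
  obtain w where w: "incseq w" "\<And>i. ereal x < ereal (w i)" "\<And>i. ereal (w i) < reach x" "(\<lambda>i. ereal (w i)) \<longlonglongrightarrow> reach x"
    using ereal_incseq_approx[OF xr] by blast
  let ?B = "{y. x \<le> y \<and> ereal y \<le> reach x}" and ?E = "{y. ereal y = reach x}"
  have E: "emeasure N ?E = 0"
  proof (cases "reach x")
    case (real r)
    then have "?E = {r}" by auto
    then show ?thesis by simp
  next
    case PInf then have "?E = {}" by auto
    then show ?thesis by (simp only: emeasure_empty)
  next
    case MInf then have "?E = {}" by auto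
    then show ?thesis by (simp only: emeasure_empty)
  qed
  have "?B \<subseteq> (\<Union>i. {x..w i}) \<union> ?E"
  proof
    fix y assume y: "y \<in> ?B"
    show "y \<in> (\<Union>i. {x..w i}) \<union> ?E"
    proof (cases "ereal y = reach x")
      case False
      then have "ereal y < reach x" using y by auto
      from order_tendstoD(1)[OF w(4) this] obtain i where "y < w i" by (auto simp: eventually_sequentially)
      then show ?thesis using y by (auto intro!: exI[of _ i])
    qed simp
  qed
  then have "travel_time x \<le> emeasure N ((\<Union>i. {x..w i}) \<union> ?E)"
    unfolding travel_time_def by (intro emeasure_mono) auto
  also have "\<dots> \<le> emeasure N (\<Union>i. {x..w i}) + emeasure N ?E"
    by (intro emeasure_subadditive) auto
  also have "\<dots> = (SUP i. emeasure N {x..w i})"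
    using w(1) unfolding E by (subst SUP_emeasure_incseq) (auto simp: incseq_def intro: order_trans)
  finally have le: "travel_time x \<le> (SUP i. emeasure N {x..w i})" .
  assume "c < travel_time x"
  then have "c < (SUP i. emeasure N {x..w i})" using le by simp
  then obtain i where "c < emeasure N {x..w i}" by (auto simp: less_SUP_iff)
  then show "\<exists>z\<ge>x. ereal z < reach x \<and> c < emeasure N {x..z}"
    using w(2,3)[of i] by (intro exI[of _ "w i"]) auto
next
  assume "\<exists>z\<ge>x. ereal z < reach x \<and> c < emeasure N {x..z}"
  then obtain z where z: "x \<le> z" "ereal z < reach x" "c < emeasure N {x..z}" by auto
  have "emeasure N {x..z} \<le> travel_time x"
    unfolding travel_time_def
  proof (intro emeasure_mono subsetI)
    fix u assume "u \<in> {x..z}"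
    then show "u \<in> {y. x \<le> y \<and> ereal y \<le> reach x}" using z(2) by (auto intro: order_trans[of _ "ereal z"])
  qed simp
  then show "c < travel_time x" using z by simp
qed

lemma flow_right_unique:
  assumes "x \<le> y" "ereal y < reach x" "emeasure N {x..y} = ennreal t"
  shows "flow_right x t = y"
proof -
  obtain z where z: "y < z" "ereal z < reach x" using ereal_dense2[OF assms(2)] by auto
  have fin: "emeasure N {x..y} < \<infinity>" by (simp add: assms)
  have "x < z" using z assms by simp
  then have ex: "\<exists>y>x. passable x y" using passable_below_reach[of x z] z by auto
  have "ennreal t < emeasure N {x..z}" using N_strict[OF assms(1) z(1) fin] assms by simp
  then have "ennreal t < travel_time x" using z assms unfolding travel_time_gt[OF ex] by (intro exI[of _ z]) auto
  moreover have "u = y" if "x \<le> u \<and> ereal u < reach x \<and> emeasure N {x..u} = ennreal t" for u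
    using N_strict[of x y u] N_strict[of x u y] that assms fin by (cases u y rule: linorder_cases) auto
  then have "(THE u. x \<le> u \<and> ereal u < reach x \<and> emeasure N {x..u} = ennreal t) = y"
    using assms by (intro the_equality conjI)
  ultimately show ?thesis by (simp add: flow_right_def)
qed

text \<open>Restricted to [x,w], N is a finite measure without atoms, so its distribution function
  is continuous and takes the value t.\<close>

lemma ex_flow_right:
  assumes ex: "\<exists>y>x. passable x y" and t: "0 \<le> t" "ennreal t < travel_time x"
  shows "\<exists>y. x \<le> y \<and> ereal y < reach x \<and> emeasure N {x..y} = ennreal t"
proof -
  obtain w where w: "x \<le> w" "ereal w < reach x" "ennreal t < emeasure N {x..w}"
    using t travel_time_gt[OF ex] by auto
  have fin: "emeasure N {x..w} < \<infinity>" using passable_below_reach[OF w(1,2)] by (simp add: passable_def)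
  define M where "M = density N (indicator {x..w})"
  have M: "emeasure M A = emeasure N ({x..w} \<inter> A)" if "A \<in> sets borel" for A
    using that by (simp add: M_def emeasure_density indicator_inter_arith[symmetric])
  have [simp]: "space M = UNIV" "sets M = sets borel"
    using sets_eq_imp_space_eq[OF sets_N] by (auto simp: M_def)
  have "emeasure M (space M) \<noteq> \<infinity>"
    using fin M[of UNIV] by (simp add: less_top)
  then interpret M: finite_borel_measure M
    by (intro finite_borel_measure.intro finite_measureI finite_borel_measure_axioms.intro) simp_all
  have cdf: "cdf M z = enn2real (emeasure N {x..z})" if "z \<le> w" for z
  proof -
    have "{x..w} \<inter> {..z} = {x..z}" using that by auto
    then have "emeasure M {..z} = emeasure N {x..z}" using M[of "{..z}"] that by (simp add: min_absorb2)
    then show ?thesis by (simp add: cdf_def measure_def)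
  qed
  have "isCont (cdf M) z" for z
    unfolding M.isCont_cdf
    using emeasure_mono[of "{x..w} \<inter> {z}" "{z}" N] by (simp add: measure_def M)
  then have cont: "continuous_on {x..w} (cdf M)" by (simp add: continuous_at_imp_continuous_on)
  have "cdf M x \<le> t" using cdf[of x] w t by simp
  moreover have "t \<le> cdf M w"
    using cdf[of w] w(3) fin t by (cases "emeasure N {x..w}") (auto simp: ennreal_less_iff)
  ultimately
  obtain y where y: "x \<le> y" "y \<le> w" "cdf M y = t"
    using IVT'[of "cdf M" x t w] cont w by auto
  have "emeasure N {x..y} \<le> emeasure N {x..w}" using y by (intro emeasure_mono) auto
  then have "emeasure N {x..y} < \<infinity>" using fin by simp
  then have "emeasure N {x..y} = ennreal t" using y cdf[of y] by (metis ennreal_enn2real infinity_ennreal_def)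
  moreover have "ereal y \<le> ereal w" using y by simp
  then have "ereal y < reach x" using w(2) by (rule le_less_trans)
  ultimately show ?thesis using y by auto
qed

end

section \<open>The flow to the right\<close>

context flow_data
begin

text \<open>Just to the right of x, f exceeds r/2, which bounds 1/f and excludes mass of mu and
  points of Sg. The point x itself needs f x nonzero, because it could otherwise belong to
  Sg.\<close>

lemma passable_if_right_lim_pos:
  assumes "f x \<noteq> 0" "(f \<longlongrightarrow> r) (at_right x)" "0 < r"
  shows "\<exists>y>x. passable x y"
proof -
  have "eventually (\<lambda>u. r / 2 < f u) (at_right x)"
    using assms(2,3) by (intro order_tendstoD(1)[of _ r]) auto
  then obtain b where b: "x < b" "\<And>u. x < u \<Longrightarrow> u < b \<Longrightarrow> r / 2 < f u"
    by (auto simp: eventually_at_right_field)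
  define y where "y = (x + b) / 2"
  have y: "x < y" "\<And>u. x < u \<Longrightarrow> u \<le> y \<Longrightarrow> r / 2 < f u" using b by (auto simp: y_def)
  have pos: "f u \<noteq> 0" if "x \<le> u" "u \<le> y" for u
    using y(2)[of u] assms(1,3) that by (cases "x = u") auto
  have "u \<notin> Sg" if "x \<le> u" "u \<le> y" for u
    using pos[OF that] Sg_zero by auto
  then have "{x..y} \<inter> Sg = {}" by auto
  moreover have "emeasure N {x..y} < \<infinity>"
  proof -
    have mu: "emeasure \<mu> {x..y} = 0"
    proof -
      have "f -` (- {0}) \<in> sets borel"
        using measurable_sets_borel[OF f_meas] by simp
      moreover have "UNIV - f -` {0} = f -` (- {0})" by auto
      ultimately have "emeasure \<mu> {x..y} \<le> emeasure \<mu> (UNIV - f -` {0})"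
        using pos by (intro emeasure_mono) (auto simp: sets_mu)
      then show ?thesis using supp by simp
    qed
    have "AE z in lborel. indicator {x..y} z * inv_fp f z \<le> ennreal (2 / r) * indicator {x..y} z"
      using AE_lborel_singleton[of x]
    proof eventually_elim
      case (elim z)
      have "inv_fp f z \<le> ennreal (2 / r)" if "x \<le> z" "z \<le> y"
      proof -
        have "r / 2 < f z" using y(2)[of z] that elim by auto
        then have "1 / f z \<le> 2 / r" "0 < f z" using assms(3) by (auto simp: field_simps)
        then show ?thesis by (simp add: inv_fp_def ennreal_leI)
      qed
      then show ?case by (auto split: split_indicator)
    qed
    then have "int_on {x..y} (inv_fp f) \<le> (\<integral>\<^sup>+z. ennreal (2 / r) * indicator {x..y} z \<partial>lborel)"
      unfolding int_on_def by (rule nn_integral_mono_AE)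
    also have "\<dots> < \<infinity>" using y by (simp add: nn_integral_cmult_indicator ennreal_mult_less_top)
    finally show ?thesis using mu by (simp add: emeasure_N)
  qed
  ultimately show ?thesis using y(1) by (auto simp: passable_def)
qed

context
  fixes x assumes ex: "\<exists>y>x. passable x y"
begin

lemma flow_right_before:
  assumes "0 \<le> t" "ennreal t < travel_time x"
  shows "x \<le> flow_right x t" "ereal (flow_right x t) < reach x" "emeasure N {x..flow_right x t} = ennreal t"
proof -
  obtain y where y: "x \<le> y" "ereal y < reach x" "emeasure N {x..y} = ennreal t"
    using ex_flow_right[OF ex assms] by blast
  have "flow_right x t = y" using y by (rule flow_right_unique)
  then show "x \<le> flow_right x t" "ereal (flow_right x t) < reach x" "emeasure N {x..flow_right x t} = ennreal t"
    using y by simp_all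
qed

lemma flow_right_after: "travel_time x \<le> ennreal t \<Longrightarrow> flow_right x t = real_of_ereal (reach x)"
  by (auto simp: flow_right_def)

lemma reach_gt: "ereal x < reach x"
proof -
  obtain y where "x < y" "passable x y" using ex by blast
  then have "ereal x < ereal y" "ereal y \<le> reach x" using passable_le_reach by auto
  then show ?thesis by (rule less_le_trans)
qed

text \<open>Bounded speed: an unbounded domain cannot be crossed in finite time.\<close>

lemma reach_finite:
  assumes "travel_time x < \<infinity>"
  obtains \<beta> where "reach x = ereal \<beta>" "x < \<beta>" "emeasure N {x..\<beta>} = travel_time x"
proof -
  obtain T where T: "0 \<le> T" "travel_time x = ennreal T" using assms by (cases "travel_time x") auto
  obtain k where k: "k > 0" "\<And>c d. c \<le> d \<Longrightarrow> ennreal (k * (d - c)) \<le> emeasure N {c..d}"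
    using N_lower by blast
  have "reach x \<noteq> \<infinity>"
  proof
    assume inf: "reach x = \<infinity>"
    \<comment> \<open>Chosen so that the lower bound k on the time per unit length already gives T +
      1.\<close>
    let ?z = "x + (T + 1) / k"
    have z: "x \<le> ?z" using T k by simp
    have "ennreal T < ennreal (k * (?z - x))" using k T by (simp add: ennreal_less_iff)
    also have "\<dots> \<le> emeasure N {x..?z}" using k(2)[OF z] .
    finally have "ennreal T < travel_time x"
      unfolding travel_time_gt[OF ex] using inf z by (intro exI[of _ ?z]) simp
    then show False using T by simp
  qed
  then obtain \<beta> where \<beta>: "reach x = ereal \<beta>" using reach_gt by (cases "reach x") auto
  have "{y. x \<le> y \<and> ereal y \<le> reach x} = {x..\<beta>}" using \<beta> by auto
  then have "emeasure N {x..\<beta>} = travel_time x" by (simp add: travel_time_def)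
  then show ?thesis using that \<beta> reach_gt by simp
qed

text \<open>Finite travel time makes [x,beta] of finite N-measure, so passability from beta onwards
  would extend passability from x beyond its supremum. Thus a stopped path is at a point where the
  rule for the right no longer applies.\<close>

lemma not_passable_beyond_reach:
  assumes "travel_time x < \<infinity>" "reach x = ereal \<beta>" "\<beta> < y"
  shows "\<not> passable \<beta> y"
proof
  assume p: "passable \<beta> y"
  obtain b where "reach x = ereal b" "x < b" "emeasure N {x..b} = travel_time x"
    by (rule reach_finite[OF assms(1)])
  then have b: "x < \<beta>" "emeasure N {x..\<beta>} < \<infinity>" using assms(1,2) by auto
  have "u \<notin> Sg" if "x \<le> u" "u \<le> y" for u
  proof (cases "u < \<beta>")
    case True
    then have "passable x u" using passable_below_reach[OF that(1)] assms(2) by simp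
    then show ?thesis using that(1) by (auto simp: passable_def)
  next
    case False
    then show ?thesis using p that by (auto simp: passable_def disjoint_iff)
  qed
  then have "passable x y"
    using b p assms(3) by (auto simp: passable_def N_split[of x \<beta> y])
  from passable_le_reach[OF this] show False using assms by simp
qed

text \<open>Points on the path before it stops share the same \<open>reach\<close>, and N is
  additive over adjacent intervals, so elapsed times add.\<close>

lemma flow_right_shift:
  assumes s: "0 \<le> s" "ennreal s < travel_time x"
  defines "y \<equiv> flow_right x s"
  shows "\<exists>z>y. passable y z" and "\<And>t. 0 \<le> t \<Longrightarrow> flow_right y t = flow_right x (t + s)"
proof -
  have y: "x \<le> y" "ereal y < reach x" "emeasure N {x..y} = ennreal s"
    unfolding y_def by (rule flow_right_before[OF s])+
  have pxy: "passable x y" using y(1,2) by (rule passable_below_reach)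
  obtain z where z: "y < z" "ereal z < reach x" using ereal_dense2[OF y(2)] by auto
  have "passable x z" using z y by (intro passable_below_reach) auto
  then have "passable y z" by (rule passable_right) (use y z in auto)
  then show exy: "\<exists>z>y. passable y z" using z by blast
  have reach: "reach y = reach x"
  proof (rule antisym)
    show "reach y \<le> reach x"
      unfolding reach_def by (rule SUP_subset_mono) (use passable_trans[OF pxy] in auto)
    show "reach x \<le> reach y"
      unfolding reach_def[of x]
    proof (rule SUP_least)
      fix u assume "u \<in> {u. passable x u}"
      then have u: "passable x u" by simp
      show "ereal u \<le> reach y"
      proof (cases "y \<le> u")
        case True
        then show ?thesis using passable_right[OF u y(1)] passable_le_reach by blast
      next
        case False
        have "passable y y" using passable_right[OF pxy y(1)] by simp
        then have "ereal y \<le> reach y" by (rule passable_le_reach)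
        moreover have "ereal u \<le> ereal y" using False by simp
        ultimately show ?thesis by (rule order_trans[rotated])
      qed
    qed
  qed
  fix t :: real assume t: "0 \<le> t"
  have add: "emeasure N {x..w} = ennreal s + emeasure N {y..w}" if "y \<le> w" for w
    using N_split[OF y(1) that] y(3) by simp
  have ts: "ennreal (t + s) = ennreal s + ennreal t" using t s by (simp add: add.commute ennreal_plus)
  show "flow_right y t = flow_right x (t + s)"
  proof (cases "ennreal (t + s) < travel_time x")
    case True
    define w where "w = flow_right x (t + s)"
    have w: "x \<le> w" "ereal w < reach x" "emeasure N {x..w} = ennreal (t + s)"
      unfolding w_def using flow_right_before[of "t + s"] True t s by simp_all
    have yw: "y \<le> w"
    proof (rule ccontr)
      assume "\<not> y \<le> w"
      then have "emeasure N {x..w} < emeasure N {x..y}" using w by (intro N_strict) auto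
      then show False using w y t s by (simp add: ennreal_less_iff)
    qed
    have "emeasure N {y..w} = ennreal t"
      using add[OF yw] w(3) ts by (simp add: ennreal_add_left_cancel)
    then show ?thesis using flow_right_unique[of y w t] yw w(2) reach by (simp add: w_def)
  next
    case False
    have "\<not> ennreal t < travel_time y"
    proof
      assume "ennreal t < travel_time y"
      then obtain z where z: "y \<le> z" "ereal z < reach y" "ennreal t < emeasure N {y..z}"
        unfolding travel_time_gt[OF exy] by blast
      have "ennreal (t + s) < emeasure N {x..z}"
        unfolding add[OF z(1)] ts using z(3) by (simp add: ennreal_add_left_cancel_less)
      then have "ennreal (t + s) < travel_time x"
        unfolding travel_time_gt[OF ex] using z y reach by (intro exI[of _ z]) auto
      with False show False by simp
    qed
    then show ?thesis using False reach by (simp add: flow_right_def)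
  qed
qed

text \<open>Until the travel time the path inverts N, including its final instant at the endpoint;
  afterwards it rests, which is a solution only if f vanishes at the endpoint, hence
  \<open>stop\<close>.\<close>

lemma flow_right_caratheodory:
  assumes stop: "travel_time x < \<infinity> \<Longrightarrow> f (real_of_ereal (reach x)) = 0"
  shows "caratheodory_sol f x (flow_right x)"
  unfolding caratheodory_sol_def
proof (intro allI impI)
  have upto: "((\<lambda>s. f (flow_right x s)) has_integral (flow_right x t - x)) {0..t}"
    if t: "0 \<le> t" "ennreal t \<le> travel_time x" for t
  proof (rule time_inverse_has_integral[OF t(1)])
    fix s assume s: "0 \<le> s" "s \<le> t"
    then have st: "ennreal s \<le> ennreal t" by (simp add: ennreal_leI)
    show "x \<le> flow_right x s \<and> emeasure N {x..flow_right x s} = ennreal s"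
    proof (cases "ennreal s < travel_time x")
      case True
      then show ?thesis using flow_right_before s(1) by blast
    next
      case False
      then have eq: "travel_time x = ennreal s"
        using order_trans[OF st t(2)] by (intro antisym) auto
      then have "travel_time x < \<infinity>" by simp
      then obtain \<beta> where "reach x = ereal \<beta>" "x < \<beta>" "emeasure N {x..\<beta>} = travel_time x"
        by (rule reach_finite)
      then show ?thesis using flow_right_after[of s] eq by simp
    qed
  qed
  fix t :: real assume t: "0 \<le> t"
  show "((\<lambda>s. f (flow_right x s)) has_integral (flow_right x t - x)) {0..t}"
  proof (cases "ennreal t \<le> travel_time x")
    case True
    then show ?thesis using upto t by blast
  next
    case False
    then obtain T where T: "0 \<le> T" "travel_time x = ennreal T" "T \<le> t"
      by (cases "travel_time x") auto
    have const: "flow_right x s = real_of_ereal (reach x)" if "T \<le> s" for s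
      using flow_right_after[of s] T that by (simp add: ennreal_leI)
    have "((\<lambda>s. 0 :: real) has_integral 0) {T..t}" by simp
    then have "((\<lambda>s. f (flow_right x s)) has_integral 0) {T..t}"
      by (rule has_integral_eq[rotated]) (use const stop T in auto)
    from has_integral_combine[OF T(1,3) upto[OF T(1)] this]
    show ?thesis using const[of T] const[of t] T by simp
  qed
qed

end
end

section \<open>Reflection\<close>

text \<open>The right-hand side of the mirrored equation: if x solves the equation for f, then -x
  solves it for \<open>reflect f\<close>.\<close>

definition reflect :: "(real \<Rightarrow> real) \<Rightarrow> real \<Rightarrow> real" where
  "reflect f x = - f (- x)"

lemma reflect_reflect [simp]: "reflect (reflect f) = f"
  by (simp add: reflect_def fun_eq_iff)

lemma tendsto_reflect:
  "(f \<longlongrightarrow> l) (at_right (- x)) \<Longrightarrow> (reflect f \<longlongrightarrow> - l) (at_left x)"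
  "(f \<longlongrightarrow> l) (at_left (- x)) \<Longrightarrow> (reflect f \<longlongrightarrow> - l) (at_right x)"
  unfolding at_left_minus[of x] at_right_minus[of x] filterlim_filtermap reflect_def
  by (auto intro: tendsto_minus)

lemma A1_reflect:
  assumes "A1 f" shows "A1 (reflect f)"
proof -
  have "bounded (uminus ` range f)" using assms by (simp add: A1_def)
  then have "bounded (range (reflect f))"
    by (rule bounded_subset) (auto simp: reflect_def)
  moreover have "\<exists>l. (reflect f \<longlongrightarrow> l) (at_left x)" "\<exists>l. (reflect f \<longlongrightarrow> l) (at_right x)" for x
    using assms tendsto_reflect[of f _ x] unfolding A1_def by blast+
  ultimately show ?thesis unfolding A1_def by blast
qed

lemma A1_left_lim: "A1 f \<Longrightarrow> (f \<longlongrightarrow> left_lim f x) (at_left x)"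
  and A1_right_lim: "A1 f \<Longrightarrow> (f \<longlongrightarrow> right_lim f x) (at_right x)"
  unfolding A1_def left_lim_def right_lim_def using tendsto_Lim by (metis trivial_limit_at_left_real trivial_limit_at_right_real)+

lemma inv_fp_reflect: "inv_fp (reflect f) y = inv_fm f (- y)"
  by (simp add: inv_fp_def inv_fm_def reflect_def)

lemma int_on_reflect:
  assumes [measurable]: "f \<in> borel_measurable borel" "A \<in> sets borel"
  shows "int_on (uminus ` A) (inv_fp (reflect f)) = int_on A (inv_fm f)"
proof -
  have [measurable]: "inv_fm f \<in> borel_measurable borel" unfolding inv_fm_def by measurable
  have "indicator (uminus ` A) y * inv_fp (reflect f) y = indicator A (- y) * inv_fm f (- y)" for y
    by (auto simp: inv_fp_reflect image_iff minus_equation_iff split: split_indicator)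
  then have "int_on (uminus ` A) (inv_fp (reflect f)) = (\<integral>\<^sup>+y. indicator A (- y) * inv_fm f (- y) \<partial>lborel)"
    by (simp add: int_on_def)
  also have "\<dots> = (\<integral>\<^sup>+y. indicator A y * inv_fm f y \<partial>distr lborel borel uminus)"
    by (subst nn_integral_distr) auto
  finally show ?thesis by (simp add: lborel_distr_uminus int_on_def)
qed

abbreviation reflect_measure :: "real measure \<Rightarrow> real measure" where
  "reflect_measure \<mu> \<equiv> distr \<mu> borel uminus"

lemma mem_uminus_image: "z \<in> uminus ` A \<longleftrightarrow> - z \<in> A" for z :: real
  by (metis image_iff minus_minus)

lemma borel_uminus_image: "A \<in> sets borel \<Longrightarrow> uminus ` A \<in> sets borel" for A :: "real set"
proof -
  assume "A \<in> sets borel"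
  moreover have "(uminus :: real \<Rightarrow> real) \<in> borel_measurable borel" by measurable
  ultimately have "uminus -` A \<in> sets borel" by (rule measurable_sets_borel[rotated])
  moreover have "uminus -` A = uminus ` A" by (auto simp: mem_uminus_image)
  ultimately show ?thesis by simp
qed

lemma emeasure_reflect:
  assumes "sets \<mu> = sets borel" "A \<in> sets borel"
  shows "emeasure (reflect_measure \<mu>) (uminus ` A) = emeasure \<mu> A"
proof -
  have m: "uminus \<in> measurable \<mu> borel" using assms(1) by (simp cong: measurable_cong_sets)
  have "uminus -` (uminus ` A) = A" by (auto simp: mem_uminus_image)
  then show ?thesis
    using m sets_eq_imp_space_eq[OF assms(1)] borel_uminus_image[OF assms(2)] by (subst emeasure_distr) auto
qed

lemma reflect_measure_twice: "sets \<mu> = sets borel \<Longrightarrow> reflect_measure (reflect_measure \<mu>) = \<mu>"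
  by (subst distr_distr) (auto simp: comp_def distr_id2 cong: measurable_cong_sets)

lemma open_interval_uminus [simp]: "open_interval (uminus ` D) \<longleftrightarrow> open_interval D"
proof -
  have "open_interval (uminus ` D)" if "open_interval D" for D
    using that open_negations[of D] unfolding open_interval_def is_interval_connected_1
    by (auto intro!: connected_continuous_image continuous_intros)
  from this[of D] this[of "uminus ` D"] show ?thesis by (auto simp: image_image)
qed

context flow_data
begin

lemma flow_data_reflect: "flow_data (reflect f) (reflect_measure \<mu>) (uminus ` Sg)"
proof
  show "A1 (reflect f)" by (rule A1_reflect[OF A1])
  have m: "f -` (- {0}) \<in> sets borel" using measurable_sets_borel[OF f_meas] by simp
  show "emeasure (reflect_measure \<mu>) {x} = 0" for x
    using emeasure_reflect[OF sets_mu, of "{- x}"] by (simp add: atomless)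
  have "UNIV - reflect f -` {0} = uminus ` (f -` (- {0}))"
    by (auto simp: reflect_def mem_uminus_image)
  moreover have "UNIV - f -` {0} = f -` (- {0})" by auto
  ultimately show "emeasure (reflect_measure \<mu>) (UNIV - reflect f -` {0}) = 0"
    using emeasure_reflect[OF sets_mu m] supp by simp
  show "uminus ` Sg \<subseteq> reflect f -` {0}" using Sg_zero by (auto simp: reflect_def)
qed simp

interpretation R: flow_data "reflect f" "reflect_measure \<mu>" "uminus ` Sg"
  by (rule flow_data_reflect)

text \<open>\<open>R.N\<close> is the travel-time measure to the left, in mirrored
  coordinates.\<close>

lemma reflect_N: "A \<in> sets borel \<Longrightarrow> emeasure R.N (uminus ` A) = emeasure \<mu> A + int_on A (inv_fm f)"
proof -
  assume A: "A \<in> sets borel"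
  have "uminus ` A \<in> sets borel" using A by (rule borel_uminus_image)
  then show ?thesis using A by (simp add: R.emeasure_N emeasure_reflect sets_mu int_on_reflect)
qed

lemma dom_dec_iff: "dom_dec f \<mu> Sg D \<longleftrightarrow> dom_inc (reflect f) (reflect_measure \<mu>) (uminus ` Sg) (uminus ` D)"
proof -
  have "(\<forall>c d. {c..d} \<subseteq> D \<longrightarrow> emeasure \<mu> {c..d} + int_on {c..d} (inv_fm f) < \<infinity>) \<longleftrightarrow>
        (\<forall>c d. {c..d} \<subseteq> uminus ` D \<longrightarrow> emeasure R.N {c..d} < \<infinity>)" (is "?L \<longleftrightarrow> ?R")
  proof
    assume L: ?L
    show ?R
    proof (intro allI impI)
      fix c d assume "{c..d} \<subseteq> uminus ` D"
      then have "{-d..-c} \<subseteq> D"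
        using image_mono[of "{c..d}" "uminus ` D" uminus] by (simp add: image_image)
      then show "emeasure R.N {c..d} < \<infinity>" using L reflect_N[of "{-d..-c}"] by simp
    qed
  next
    assume R: ?R
    show ?L
    proof (intro allI impI)
      fix c d assume "{c..d} \<subseteq> D"
      then have "{-d..-c} \<subseteq> uminus ` D" using image_mono[of "{c..d}" D uminus] by simp
      then have "emeasure R.N {-d..-c} < \<infinity>" using R by blast
      then show "emeasure \<mu> {c..d} + int_on {c..d} (inv_fm f) < \<infinity>" using reflect_N[of "{c..d}"] by simp
    qed
  qed
  moreover have "uminus ` D \<inter> uminus ` Sg = {} \<longleftrightarrow> D \<inter> Sg = {}" by auto
  ultimately show ?thesis
    unfolding dom_dec_def dom_inc_def by (simp add: R.emeasure_N)
qed

lemma max_dom_dec_iff: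
  "max_dom_dec f \<mu> Sg D \<longleftrightarrow> max_dom_inc (reflect f) (reflect_measure \<mu>) (uminus ` Sg) (uminus ` D)"
proof -
  have all: "(\<forall>E. Q E) \<longleftrightarrow> (\<forall>E. Q (uminus ` E))" for Q :: "real set \<Rightarrow> bool"
  proof
    assume q: "\<forall>E. Q (uminus ` E)"
    show "\<forall>E. Q E" using q[rule_format, of "uminus ` _"] by (simp add: image_image)
  qed blast
  have inj: "uminus ` A = uminus ` B \<longleftrightarrow> A = B" "uminus ` A \<subseteq> uminus ` B \<longleftrightarrow> A \<subseteq> B" for A B :: "real set"
    by (auto simp: inj_image_eq_iff inj_image_subset_iff)
  show ?thesis
    unfolding max_dom_dec_def max_dom_inc_def dom_dec_iff
    by (subst (2) all) (simp add: inj)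
qed

lemma I_minus_iff:
  "x \<in> I_minus f \<mu> Sg D \<longleftrightarrow> - x \<in> I_plus (reflect f) (reflect_measure \<mu>) (uminus ` Sg) (uminus ` D)"
proof -
  have 1: "- x = Inf (uminus ` D) \<longleftrightarrow> x = Sup D" by (auto simp: Inf_real_def image_image)
  have 2: "emeasure (reflect_measure \<mu>) {- x..- x + \<epsilon>} + int_on {- x..- x + \<epsilon>} (inv_fp (reflect f))
      = emeasure \<mu> {x - \<epsilon>..x} + int_on {x - \<epsilon>..x} (inv_fm f)" for \<epsilon>
    using reflect_N[of "{x - \<epsilon>..x}"] R.emeasure_N[of "{- x..- x + \<epsilon>}"] by simp
  have 3: "bdd_below (uminus ` D) \<longleftrightarrow> bdd_above D" by (simp add: bdd_below_uminus)
  have 4: "- x \<in> uminus ` D \<longleftrightarrow> x \<in> D" "- x \<in> uminus ` Sg \<longleftrightarrow> x \<in> Sg" by auto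
  show ?thesis unfolding I_minus_def I_plus_def Un_iff mem_Collect_eq by (simp only: 1 2 3 4)
qed

lemma U_minus_iff_U_plus: "x \<in> U_minus f \<mu> Sg \<longleftrightarrow> - x \<in> U_plus (reflect f) (reflect_measure \<mu>) (uminus ` Sg)"
proof
  assume "x \<in> U_minus f \<mu> Sg"
  then obtain D where D: "max_dom_dec f \<mu> Sg D" "x \<in> I_minus f \<mu> Sg D" by (auto simp: U_minus_def)
  then show "- x \<in> U_plus (reflect f) (reflect_measure \<mu>) (uminus ` Sg)"
    using I_minus_iff max_dom_dec_iff unfolding U_plus_def by blast
next
  assume "- x \<in> U_plus (reflect f) (reflect_measure \<mu>) (uminus ` Sg)"
  then obtain E where E: "max_dom_inc (reflect f) (reflect_measure \<mu>) (uminus ` Sg) E"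
    "- x \<in> I_plus (reflect f) (reflect_measure \<mu>) (uminus ` Sg) E" by (auto simp: U_plus_def)
  define D where "D = uminus ` E"
  have ED: "E = uminus ` D" by (simp add: D_def image_image)
  have D: "max_dom_dec f \<mu> Sg D" using E(1) unfolding max_dom_dec_iff ED .
  moreover have "x \<in> I_minus f \<mu> Sg D"
    using E(2) unfolding I_minus_iff ED .
  ultimately show "x \<in> U_minus f \<mu> Sg" unfolding U_minus_def by blast
qed

lemma U_minus_iff: "x \<in> U_minus f \<mu> Sg \<longleftrightarrow> (\<exists>y>-x. R.passable (- x) y)"
  by (simp add: U_minus_iff_U_plus R.U_plus_iff)

text \<open>The infimum of D, the total time and the time function of \<open>S_minus\<close> each
  turn into their mirrored counterparts; uniqueness in the description operator comes from
  \<open>R.flow_right_unique\<close>.\<close>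

lemma S_minus_eq:
  assumes D: "max_dom_dec f \<mu> Sg D" "x \<in> I_minus f \<mu> Sg D" and t: "0 \<le> t"
  shows "S_minus f \<mu> D x t = - R.flow_right (- x) t"
proof -
  have D': "max_dom_inc (reflect f) (reflect_measure \<mu>) (uminus ` Sg) (uminus ` D)"
    "- x \<in> I_plus (reflect f) (reflect_measure \<mu>) (uminus ` Sg) (uminus ` D)"
    using D max_dom_dec_iff I_minus_iff by auto
  have "x \<in> U_minus f \<mu> Sg" using D unfolding U_minus_def by blast
  then have ex: "\<exists>y>-x. R.passable (- x) y" by (simp add: U_minus_iff)
  have "Sup (ereal ` uminus ` D) = R.reach (- x)" using R.Sup_max_dom_inc[OF D'] .
  moreover have "Sup (ereal ` uminus ` D) = - Inf (ereal ` D)"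
    by (simp add: image_image flip: uminus_ereal.simps(1) ereal_Sup_uminus_image_eq)
  ultimately have inf: "Inf (ereal ` D) = - R.reach (- x)" by (simp add: ereal_uminus_eq_reorder)
  let ?r = "R.reach (- x)"
  have G: "emeasure \<mu> {y..x} + int_on {y..x} (inv_fm f) = emeasure R.N {- x..- y}" for y
    using reflect_N[of "{y..x}"] by simp
  have "{y. - ?r \<le> ereal y \<and> y \<le> x} = uminus ` {z. - x \<le> z \<and> ereal z \<le> ?r}"
  proof (intro set_eqI iffI)
    fix y assume "y \<in> {y. - ?r \<le> ereal y \<and> y \<le> x}"
    then have "- y \<in> {z. - x \<le> z \<and> ereal z \<le> ?r}" by (auto simp: ereal_uminus_le_reorder)
    then show "y \<in> uminus ` {z. - x \<le> z \<and> ereal z \<le> ?r}" by (simp only: mem_uminus_image)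
  qed (auto simp: ereal_uminus_le_reorder)
  then have "uminus ` {y. - ?r \<le> ereal y \<and> y \<le> x} = {z. - x \<le> z \<and> ereal z \<le> ?r}"
    by (simp add: image_image)
  then have T: "emeasure \<mu> {y. - ?r \<le> ereal y \<and> y \<le> x} + int_on {y. - ?r \<le> ereal y \<and> y \<le> x} (inv_fm f)
      = R.travel_time (- x)"
    using reflect_N[of "{y. - ?r \<le> ereal y \<and> y \<le> x}"] by (simp add: R.travel_time_def)
  show ?thesis
  proof (cases "ennreal t < R.travel_time (- x)")
    case False
    then show ?thesis unfolding S_minus_def Let_def inf T by (simp add: R.flow_right_def)
  next
    case True
    define w where "w = R.flow_right (- x) t"
    note w = R.flow_right_before[OF ex t True, folded w_def]
    have "(THE y. y \<le> x \<and> - ?r < ereal y \<and> emeasure R.N {- x..- y} = ennreal t) = - w"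
    proof (rule the_equality)
      show "- w \<le> x \<and> - ?r < ereal (- w) \<and> emeasure R.N {- x..- (- w)} = ennreal t"
        using w by (auto simp flip: uminus_ereal.simps(1))
      fix y assume y: "y \<le> x \<and> - ?r < ereal y \<and> emeasure R.N {- x..- y} = ennreal t"
      then have "R.flow_right (- x) t = - y"
        by (intro R.flow_right_unique) (auto simp: ereal_uminus_less_reorder)
      then show "y = - w" by (simp add: w_def)
    qed
    then show ?thesis unfolding S_minus_def Let_def inf T G using True by (simp add: w_def)
  qed
qed

text \<open>On the common interval [max a c, b] the first finiteness forces f > 0 almost everywhere
  and the second f < 0, although this interval has positive length.\<close>

lemma not_both_signs:
  assumes "a < b" "emeasure N {a..b} < \<infinity>" "c < b" "emeasure R.N {- b..- c} < \<infinity>"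
  shows False
proof -
  have "AE z in lborel. z \<in> {-b..-c} \<longrightarrow> reflect f z > 0" using R.AE_pos[OF assms(4)] .
  then have "AE z in distr lborel borel uminus. z \<in> {-b..-c} \<longrightarrow> reflect f z > 0"
    by (simp only: lborel_distr_uminus)
  then have "AE z in lborel. - z \<in> {-b..-c} \<longrightarrow> reflect f (- z) > 0"
    by (rule AE_distrD[rotated]) measurable
  moreover have "AE z in lborel. z \<in> {a..b} \<longrightarrow> f z > 0" using AE_pos[OF assms(2)] .
  ultimately have "AE z in lborel. z \<notin> {max a c..b}"
    by eventually_elim (auto simp: reflect_def)
  then have "emeasure lborel {max a c..b} = 0"
    by (subst (asm) AE_iff_measurable[of "{max a c..b}"]) auto
  then show False using assms(1,3) by (auto simp: ennreal_eq_0_iff max_def split: if_splits)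
qed

text \<open>Having arrived at y from the left excludes leaving y to the left, so a path in motion
  never faces the choice made by Phi.\<close>

lemma reached_not_U_minus:
  assumes "x < y" "emeasure N {x..y} < \<infinity>"
  shows "y \<notin> U_minus f \<mu> Sg"
proof
  assume "y \<in> U_minus f \<mu> Sg"
  then obtain z where "- y < z" "emeasure R.N {- y..z} < \<infinity>"
    unfolding U_minus_iff R.passable_def by blast
  then show False using not_both_signs[OF assms, of "- z"] by simp
qed

text \<open>If f x were nonzero, a positive right limit would make x start a path to the right, and
  a negative left limit one to the left. The remaining sign patterns of the two limits are exactly
  those for which (A2) gives f x = 0.\<close>

lemma zero_outside_domains:
  assumes A2: "A2 f" and "x \<notin> U_plus f \<mu> Sg" "x \<notin> U_minus f \<mu> Sg"
  shows "f x = 0"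
proof (rule ccontr)
  assume nz: "f x \<noteq> 0"
  have "\<not> 0 < right_lim f x"
    using passable_if_right_lim_pos[OF nz A1_right_lim[OF A1]] assms(2) U_plus_iff by blast
  moreover have "\<not> left_lim f x < 0"
  proof
    assume l: "left_lim f x < 0"
    have "(reflect f \<longlongrightarrow> - left_lim f x) (at_right (- x))"
      using tendsto_reflect(2)[of f "left_lim f x" "- x"] A1_left_lim[OF A1] by simp
    then have "\<exists>y>-x. R.passable (- x) y"
      by (rule R.passable_if_right_lim_pos[rotated]) (use nz l in \<open>auto simp: reflect_def\<close>)
    then show False using assms(3) U_minus_iff by blast
  qed
  moreover have "\<not> (left_lim f x * right_lim f x = 0 \<or> left_lim f x > 0 \<and> 0 > right_lim f x)"
    using A2 nz unfolding A2_def by blast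
  ultimately show False by (metis linorder_neqE_linordered_idom mult_eq_0_iff)
qed

text \<open>The third claim describes a restart at time s > 0: either the path is still moving and
  only the rule for the right applies, or it has stopped at a point outside all domains. In both
  cases the constructed map continues the same path. The case s = 0 is excluded, since x itself may
  lie in both sets.\<close>

lemma flow_right_semigroup:
  assumes A2: "A2 f" and x: "x \<in> U_plus f \<mu> Sg"
  shows "caratheodory_sol f x (flow_right x)" and "flow_right x 0 = x"
    and "0 < s \<Longrightarrow>
      flow_right x s \<in> U_plus f \<mu> Sg \<and> flow_right x s \<notin> U_minus f \<mu> Sg \<and>
        (\<forall>t\<ge>0. flow_right (flow_right x s) t = flow_right x (t + s)) \<or>
      flow_right x s \<notin> U_plus f \<mu> Sg \<and> flow_right x s \<notin> U_minus f \<mu> Sg \<and>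
        (\<forall>t\<ge>0. flow_right x (t + s) = flow_right x s)"
proof -
  have ex: "\<exists>y>x. passable x y" using x by (simp add: U_plus_iff)
  have stop: "real_of_ereal (reach x) \<notin> U_plus f \<mu> Sg \<and> real_of_ereal (reach x) \<notin> U_minus f \<mu> Sg"
    if tt: "travel_time x < \<infinity>"
  proof -
    obtain \<beta> where b: "reach x = ereal \<beta>" "x < \<beta>" "emeasure N {x..\<beta>} = travel_time x"
      by (rule reach_finite[OF ex tt])
    have "\<beta> \<notin> U_plus f \<mu> Sg" using not_passable_beyond_reach[OF ex tt b(1)] by (auto simp: U_plus_iff)
    moreover have "\<beta> \<notin> U_minus f \<mu> Sg" using reached_not_U_minus[OF b(2)] b(3) tt by simp
    ultimately show ?thesis using b by simp
  qed
  then show "caratheodory_sol f x (flow_right x)"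
    using zero_outside_domains[OF A2] by (intro flow_right_caratheodory[OF ex]) blast
  show "flow_right x 0 = x"
    by (rule flow_right_unique) (use reach_gt[OF ex] in auto)
  assume s: "0 < s"
  show "flow_right x s \<in> U_plus f \<mu> Sg \<and> flow_right x s \<notin> U_minus f \<mu> Sg \<and>
        (\<forall>t\<ge>0. flow_right (flow_right x s) t = flow_right x (t + s)) \<or>
      flow_right x s \<notin> U_plus f \<mu> Sg \<and> flow_right x s \<notin> U_minus f \<mu> Sg \<and>
        (\<forall>t\<ge>0. flow_right x (t + s) = flow_right x s)"
  proof (cases "ennreal s < travel_time x")
    case True
    have s0: "0 \<le> s" using s by simp
    note y = flow_right_before[OF ex s0 True]
    have "x \<noteq> flow_right x s" using y(3) s by auto
    then have "flow_right x s \<notin> U_minus f \<mu> Sg"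
      using y by (intro reached_not_U_minus[of x]) auto
    moreover have "flow_right x s \<in> U_plus f \<mu> Sg"
      using flow_right_shift(1)[OF ex s0 True] by (simp add: U_plus_iff)
    ultimately show ?thesis using flow_right_shift(2)[OF ex s0 True] by blast
  next
    case False
    then have tt: "travel_time x \<le> ennreal s" by simp
    have "travel_time x \<le> ennreal (t + s)" if "0 \<le> t" for t
      using that by (intro order.trans[OF tt] ennreal_leI) simp
    then have "flow_right x (t + s) = real_of_ereal (reach x)" if "0 \<le> t" for t
      using flow_right_after[OF ex] that by blast
    moreover have "flow_right x s = real_of_ereal (reach x)" using flow_right_after[OF ex tt] .
    moreover have "travel_time x < \<infinity>" using tt by (simp add: le_less_trans)
    ultimately show ?thesis using stop by simp
  qed
qed

end

lemma A2_reflect: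
  assumes "A1 f" "A2 f" shows "A2 (reflect f)"
proof -
  have "left_lim (reflect f) y = - right_lim f (- y)" "right_lim (reflect f) y = - left_lim f (- y)" for y
    unfolding left_lim_def[of "reflect f"] right_lim_def[of "reflect f"]
    by (auto intro!: tendsto_Lim tendsto_reflect A1_left_lim A1_right_lim assms)
  then show ?thesis using assms(2) unfolding A2_def by (auto simp: reflect_def mult.commute)
qed

lemma caratheodory_sol_reflect:
  assumes "caratheodory_sol (reflect f) (- x) X"
  shows "caratheodory_sol f x (\<lambda>t. - X t)"
  unfolding caratheodory_sol_def
proof (intro allI impI)
  fix t :: real assume "0 \<le> t"
  then have "((\<lambda>s. reflect f (X s)) has_integral (X t - - x)) {0..t}"
    using assms by (auto simp: caratheodory_sol_def)
  from has_integral_neg[OF this] show "((\<lambda>s. f (- X s)) has_integral (- X t - x)) {0..t}"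
    by (simp add: reflect_def)
qed

text \<open>Data determine S only for t >= 0, whereas \<open>det_semigroup\<close> is stated about
  the function S itself.\<close>

lemma det_semigroup_cong:
  assumes "\<And>x t. 0 \<le> t \<Longrightarrow> S x t = S' x t" "det_semigroup f S'"
  shows "det_semigroup f S"
proof -
  have "caratheodory_sol f x (S x)" for x
    unfolding caratheodory_sol_def
  proof (intro allI impI)
    fix t :: real assume t: "0 \<le> t"
    have "((\<lambda>s. f (S' x s)) has_integral (S x t - x)) {0..t}"
      using assms t by (auto simp: det_semigroup_def caratheodory_sol_def)
    then show "((\<lambda>s. f (S x s)) has_integral (S x t - x)) {0..t}"
      by (rule has_integral_eq[rotated]) (simp add: assms(1))
  qed
  then show ?thesis using assms by (auto simp: det_semigroup_def)
qed

section \<open>The constructed map is a deterministic semigroup\<close>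

context flow_data
begin

interpretation R: flow_data "reflect f" "reflect_measure \<mu>" "uminus ` Sg"
  by (rule flow_data_reflect)

lemma reflect_U_minus:
  "z \<in> U_minus (reflect f) (reflect_measure \<mu>) (uminus ` Sg) \<longleftrightarrow> - z \<in> U_plus f \<mu> Sg"
  using R.U_minus_iff_U_plus by (simp add: reflect_measure_twice sets_mu image_image)

lemma reflect_U_plus:
  "z \<in> U_plus (reflect f) (reflect_measure \<mu>) (uminus ` Sg) \<longleftrightarrow> - z \<in> U_minus f \<mu> Sg"
  by (simp add: U_minus_iff_U_plus)

lemma constructed_right:
  assumes "x \<in> U_plus f \<mu> Sg" "x \<notin> U_minus f \<mu> Sg \<or> \<Phi> x = 1"
  shows "constructed_semigroup f \<mu> Sg \<Phi> x t = flow_right x t"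
proof -
  let ?D = "SOME D. max_dom_inc f \<mu> Sg D \<and> x \<in> I_plus f \<mu> Sg D"
  have "\<exists>D. max_dom_inc f \<mu> Sg D \<and> x \<in> I_plus f \<mu> Sg D" using assms(1) by (auto simp: U_plus_def)
  from someI_ex[OF this] have "S_plus f \<mu> ?D x t = flow_right x t" by (intro S_plus_eq) auto
  then show ?thesis using assms by (simp add: constructed_semigroup_def)
qed

lemma constructed_left:
  assumes "x \<in> U_minus f \<mu> Sg" "x \<notin> U_plus f \<mu> Sg \<or> \<Phi> x \<noteq> 1" "0 \<le> t"
  shows "constructed_semigroup f \<mu> Sg \<Phi> x t = - R.flow_right (- x) t"
proof -
  let ?D = "SOME D. max_dom_dec f \<mu> Sg D \<and> x \<in> I_minus f \<mu> Sg D"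
  have "\<exists>D. max_dom_dec f \<mu> Sg D \<and> x \<in> I_minus f \<mu> Sg D" using assms(1) by (auto simp: U_minus_def)
  from someI_ex[OF this] have "S_minus f \<mu> ?D x t = - R.flow_right (- x) t"
    using assms(3) by (intro S_minus_eq) auto
  then show ?thesis using assms by (auto simp: constructed_semigroup_def)
qed

lemma constructed_fixed:
  "x \<notin> U_plus f \<mu> Sg \<Longrightarrow> x \<notin> U_minus f \<mu> Sg \<Longrightarrow> constructed_semigroup f \<mu> Sg \<Phi> x t = x"
  by (simp add: constructed_semigroup_def)

theorem det_semigroup_constructed:
  assumes A2: "A2 f"
  shows "det_semigroup f (constructed_semigroup f \<mu> Sg \<Phi>)"
proof -
  let ?C = "constructed_semigroup f \<mu> Sg \<Phi>"
  let ?U = "U_plus f \<mu> Sg" and ?V = "U_minus f \<mu> Sg"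
  have main: "?C x 0 = x \<and> (\<forall>s t. 0 \<le> s \<longrightarrow> 0 \<le> t \<longrightarrow> ?C (?C x s) t = ?C x (t + s)) \<and> caratheodory_sol f x (?C x)" for x
  proof -
    consider (right) "x \<in> ?U" "x \<notin> ?V \<or> \<Phi> x = 1" | (left) "x \<in> ?V" "x \<notin> ?U \<or> \<Phi> x \<noteq> 1" | (fixed) "x \<notin> ?U" "x \<notin> ?V"
      by blast
    then show ?thesis
    proof cases
      case right
      have C: "?C x t = flow_right x t" for t using right by (rule constructed_right)
      note F = flow_right_semigroup[OF A2 right(1)]
      have "?C (?C x s) t = ?C x (t + s)" if "0 \<le> s" "0 \<le> t" for s t
      proof (cases "s = 0")
        case True then show ?thesis by (simp add: C F(2))
      next
        case False
        then have "0 < s" using that by simp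
        from F(3)[OF this] show ?thesis
          using constructed_right[of "flow_right x s" \<Phi> t] constructed_fixed[of "flow_right x s" \<Phi> t] that
          by (auto simp: C)
      qed
      moreover have "?C x = flow_right x" using C by (rule ext)
      ultimately show ?thesis using F by simp
    next
      case left
      have C: "?C x t = - R.flow_right (- x) t" if "0 \<le> t" for t using left that by (rule constructed_left)
      have "- x \<in> U_plus (reflect f) (reflect_measure \<mu>) (uminus ` Sg)" using left by (simp add: reflect_U_plus)
      note F = R.flow_right_semigroup[OF A2_reflect[OF A1 A2] this, unfolded reflect_U_plus reflect_U_minus]
      have "?C (?C x s) t = ?C x (t + s)" if "0 \<le> s" "0 \<le> t" for s t
      proof (cases "s = 0")
        case True then show ?thesis by (simp add: C F(2))
      next
        case False
        then have "0 < s" using that by simp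
        from F(3)[OF this] show ?thesis
          using constructed_left[of "- R.flow_right (- x) s" \<Phi> t] constructed_fixed[of "- R.flow_right (- x) s" \<Phi> t] that
          by (auto simp: C)
      qed
      moreover have "?C x 0 = x" using C[of 0] F(2) by simp
      moreover have "caratheodory_sol f x (?C x)"
      proof -
        have sol: "caratheodory_sol f x (\<lambda>t. - R.flow_right (- x) t)"
          using F(1) by (rule caratheodory_sol_reflect)
        show ?thesis unfolding caratheodory_sol_def
        proof (intro allI impI)
          fix t :: real assume t: "0 \<le> t"
          have "((\<lambda>s. f (- R.flow_right (- x) s)) has_integral (?C x t - x)) {0..t}"
            using sol t C[OF t] by (simp add: caratheodory_sol_def)
          then show "((\<lambda>s. f (?C x s)) has_integral (?C x t - x)) {0..t}"
            by (rule has_integral_eq[rotated]) (simp add: C)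
        qed
      qed
      ultimately show ?thesis by blast
    next
      case fixed
      have "f x = 0" using zero_outside_domains[OF A2 fixed] .
      then show ?thesis using constructed_fixed[OF fixed] by (simp add: caratheodory_sol_def)
    qed
  qed
  show ?thesis unfolding det_semigroup_def using main by blast
qed

end

section \<open>One-dimensional semiflows\<close>

text \<open>Continuity is required in time only, never in the initial point.\<close>

locale real_flow =
  fixes S :: "real \<Rightarrow> real \<Rightarrow> real"
  assumes S0 [simp]: "S x 0 = x"
    and semi: "0 \<le> s \<Longrightarrow> 0 \<le> t \<Longrightarrow> S (S x s) t = S x (t + s)"
    and cont: "continuous_on {0..T} (S x)"
begin

definition Z :: "real set" where "Z = {x. \<forall>t\<ge>0. S x t = x}"
definition up :: "real \<Rightarrow> bool" where "up x \<longleftrightarrow> (\<exists>t>0. x < S x t)"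
definition down :: "real \<Rightarrow> bool" where "down x \<longleftrightarrow> (\<exists>t>0. S x t < x)"

lemma reflect_flow: "real_flow (\<lambda>x t. - S (- x) t)"
  by standard (auto simp: semi intro!: continuous_intros cont)

lemma cont_sub: "0 \<le> s \<Longrightarrow> continuous_on {s..t} (S x)"
  by (rule continuous_on_subset[OF cont[of t]]) auto

lemma orbit_IVT:
  assumes "0 \<le> s" "s \<le> t" "S x s \<le> c \<and> c \<le> S x t \<or> S x t \<le> c \<and> c \<le> S x s"
  shows "\<exists>u. s \<le> u \<and> u \<le> t \<and> S x u = c"
  using IVT'[of "S x" s c t] IVT2'[of "S x" t c s] assms cont_sub by blast

text \<open>Suppose the orbit rises above y and cut its excursion at a level z between y and S y u.
  The excursion starts and ends at z, so the semigroup law makes the orbit of z periodic and never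
  below z. But following that orbit up to time P leads back to y < z.\<close>

lemma return_not_above:
  assumes "S y P = y" "0 \<le> u" "u \<le> P"
  shows "S y u \<le> y"
proof (rule ccontr)
  assume "\<not> S y u \<le> y"
  define z where "z = (y + S y u) / 2"
  have z: "y < z" "z < S y u" using \<open>\<not> S y u \<le> y\<close> by (auto simp: z_def)
  have cl: "closed {r\<in>{a..b}. S y r \<le> z}" if "0 \<le> a" for a b
    using cont_sub[OF that] by (intro continuous_on_closed_Collect_le) auto
  have cp: "compact {r\<in>{a..b}. S y r \<le> z}" if "0 \<le> a" for a b
    using compact_Int_closed[OF compact_Icc[of a b] cl[OF that, of b]] by (simp add: Int_def conj_commute conj_left_commute)
  have "{r\<in>{0..u}. S y r \<le> z} \<noteq> {}" using assms z by (auto intro!: exI[of _ 0])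
  \<comment> \<open>r1 is the last time up to u at which the orbit is at or below z, and r2 below is
    the first such time after u; by continuity both are at level z exactly.\<close>
  then obtain r1 where r1: "0 \<le> r1" "r1 \<le> u" "S y r1 \<le> z" and max: "\<And>r. 0 \<le> r \<Longrightarrow> r \<le> u \<Longrightarrow> S y r \<le> z \<Longrightarrow> r \<le> r1"
    using compact_attains_sup[OF cp[of 0 u]] by auto
  have "{r\<in>{u..P}. S y r \<le> z} \<noteq> {}" using assms z by (auto intro!: exI[of _ P])
  then obtain r2 where r2: "u \<le> r2" "r2 \<le> P" "S y r2 \<le> z" and min: "\<And>r. u \<le> r \<Longrightarrow> r \<le> P \<Longrightarrow> S y r \<le> z \<Longrightarrow> r2 \<le> r"
    using compact_attains_inf[OF cp[of u P]] assms by auto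
  obtain v where v: "r1 \<le> v" "v \<le> u" "S y v = z" using orbit_IVT[of r1 u y z] r1 z by auto
  then have e1: "S y r1 = z" using max[of v] r1 by auto
  obtain w where w: "u \<le> w" "w \<le> r2" "S y w = z" using orbit_IVT[of u r2 y z] r2 z assms by auto
  then have e2: "S y r2 = z" using min[of w] r2 by auto
  have above: "z \<le> S y r" if "r1 \<le> r" "r \<le> r2" for r
  proof (rule ccontr)
    assume "\<not> z \<le> S y r"
    then have "r = r1 \<or> r = r2" using max[of r] min[of r] that r1 r2 by (cases "r \<le> u") auto
    then show False using e1 e2 \<open>\<not> z \<le> S y r\<close> by auto
  qed
  define d where "d = r2 - r1"
  have d: "0 < d" using r1 r2 e1 z by (cases "r1 = u") (auto simp: d_def)
  have Szr: "S z \<tau> = S y (\<tau> + r1)" if "0 \<le> \<tau>" for \<tau> using semi[of r1 \<tau> y] r1 that e1 by simp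
  have Szd: "S z d = z" using Szr[of d] d e2 by (simp add: d_def)
  have "\<forall>\<tau>. 0 \<le> \<tau> \<longrightarrow> \<tau> \<le> real n * d \<longrightarrow> z \<le> S z \<tau>" for n
  proof (induction n)
    case 0 then show ?case by auto
  next
    case (Suc n)
    show ?case
    proof (intro allI impI)
      fix \<tau> assume \<tau>: "0 \<le> \<tau>" "\<tau> \<le> real (Suc n) * d"
      show "z \<le> S z \<tau>"
      proof (cases "\<tau> \<le> d")
        case True
        then show ?thesis using above[of "\<tau> + r1"] Szr[OF \<tau>(1)] \<tau> by (simp add: d_def)
      next
        case False
        have "S z \<tau> = S z (\<tau> - d)" using semi[of d "\<tau> - d" z] d False Szd by simp
        then show ?thesis using Suc[rule_format, of "\<tau> - d"] False \<tau> by (simp add: algebra_simps)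
      qed
    qed
  qed
  moreover obtain n :: nat where "P - r1 \<le> real n * d" using d real_arch_simple[of "(P - r1) / d"] by (auto simp: field_simps)
  ultimately have "z \<le> S z (P - r1)" using r1 assms by simp
  then show False using Szr[of "P - r1"] r1 assms z by simp
qed

text \<open>Every u lies below a multiple of the period p. \<open>return_not_above\<close>, applied
  to the flow and to its mirror image, bounds S y u from above and below by y.\<close>

lemma return_stationary:
  assumes "0 < p" "S y p = y"
  shows "y \<in> Z"
proof -
  interpret R: real_flow "\<lambda>x t. - S (- x) t" by (rule reflect_flow)
  have per: "S y (real n * p) = y" for n
  proof (induction n)
    case (Suc n)
    then show ?case using semi[of "real n * p" p y] assms by (simp add: algebra_simps)
  qed simp
  have "S y u = y" if "0 \<le> u" for u
  proof -
    obtain n :: nat where n: "u \<le> real n * p" using assms(1) real_arch_simple[of "u / p"] by (auto simp: field_simps)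
    have "S y u \<le> y" using return_not_above[OF per that n] .
    moreover have "- S (- (- y)) u \<le> - y" by (rule R.return_not_above[of _ "real n * p"]) (use per that n in auto)
    ultimately show ?thesis by simp
  qed
  then show ?thesis by (simp add: Z_def)
qed

lemma orbit_inj:
  assumes "0 \<le> s" "0 \<le> t" "S x s = S x t" "S x s \<notin> Z"
  shows "s = t"
proof -
  have False if "0 \<le> s" "s < t" "S x s = S x t" "S x s \<notin> Z" for s t
    using return_stationary[of "t - s" "S x s"] semi[of s "t - s" x] that by simp
  then show ?thesis using assms by (metis linorder_neqE_linordered_idom)
qed

lemma Z_absorbing: "S x s \<in> Z \<Longrightarrow> 0 \<le> s \<Longrightarrow> s \<le> t \<Longrightarrow> S x t = S x s"
  using semi[of s "t - s" x] by (simp add: Z_def)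

lemma Z_fixed: "x \<in> Z \<Longrightarrow> 0 \<le> t \<Longrightarrow> S x t = x"
  by (simp add: Z_def)

lemma not_Z_before: "S x t \<notin> Z \<Longrightarrow> 0 \<le> s \<Longrightarrow> s \<le> t \<Longrightarrow> S x s \<notin> Z"
  using Z_absorbing by metis

text \<open>Otherwise the orbit would pass x again between t and the time u at which it is above x,
  and x would be stationary.\<close>

lemma up_gt:
  assumes "up x" "0 < t"
  shows "x < S x t"
proof (rule ccontr)
  assume "\<not> x < S x t"
  obtain u where u: "0 < u" "x < S x u" using assms by (auto simp: up_def)
  have "\<exists>v. min t u \<le> v \<and> v \<le> max t u \<and> S x v = x"
    using orbit_IVT[of "min t u" "max t u" x x] u assms \<open>\<not> x < S x t\<close> by (auto simp: min_def max_def)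
  then obtain v where v: "min t u \<le> v" "S x v = x" by blast
  have "0 < v" using v(1) u(1) assms(2) by (simp add: min_def split: if_splits)
  from return_stationary[OF this v(2)] show False using u by (simp add: Z_def)
qed

lemma down_lt:
  assumes "down x" "0 < t"
  shows "S x t < x"
proof -
  interpret R: real_flow "\<lambda>x t. - S (- x) t" by (rule reflect_flow)
  have "R.up (- x)" using assms by (auto simp: R.up_def down_def)
  from R.up_gt[OF this assms(2)] show ?thesis by simp
qed

lemma up_down_cases: "x \<in> Z \<or> up x \<or> down x"
proof (cases "x \<in> Z")
  case False
  then obtain t where "0 \<le> t" "S x t \<noteq> x" by (auto simp: Z_def)
  then have "0 < t" by (cases "t = 0") auto
  then show ?thesis using \<open>S x t \<noteq> x\<close> unfolding up_def down_def by (meson linorder_neqE_linordered_idom)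
qed simp

lemma up_not_Z: "up x \<Longrightarrow> x \<notin> Z" and up_not_down: "up x \<Longrightarrow> \<not> down x"
  using up_gt down_lt Z_fixed by (auto simp: up_def down_def) (metis less_asym)

text \<open>If the direction changed at S x s, a level slightly below S x s would be met both before
  and after s, which injectivity of the orbit forbids.\<close>

lemma up_next:
  assumes "up x" "0 \<le> s" "S x s \<notin> Z"
  shows "up (S x s)"
proof (rule ccontr)
  assume nup: "\<not> up (S x s)"
  then have "down (S x s)" using up_down_cases assms by blast
  then have lt: "S x (1 + s) < S x s" using down_lt[of "S x s" 1] semi[of s 1 x] assms by simp
  have "0 < s" using nup assms by (cases "s = 0") auto
  then have "x < S x s" using up_gt assms by blast
  \<comment> \<open>Above both the start and the position one time unit later, below S x s: crossed
    at a on the way up and at b on the way down.\<close>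
  define z where "z = (max x (S x (1 + s)) + S x s) / 2"
  have z: "x < z" "S x (1 + s) < z" "z < S x s" using lt \<open>x < S x s\<close> by (auto simp: z_def max_def)
  obtain a where a: "0 \<le> a" "a \<le> s" "S x a = z" using orbit_IVT[of 0 s x z] z assms by auto
  obtain b where b: "s \<le> b" "b \<le> 1 + s" "S x b = z" using orbit_IVT[of s "1 + s" x z] z assms by auto
  have "z \<notin> Z" using not_Z_before[OF assms(3) a(1,2)] a by simp
  then have "a = b" using orbit_inj[of a b x] a b by auto
  then show False using a b z by auto
qed

lemma up_mono:
  assumes "up x" "0 \<le> s" "s \<le> t"
  shows "S x s \<le> S x t"
proof (cases "S x s \<in> Z \<or> s = t")
  case True
  then show ?thesis using Z_absorbing[of x s t] assms by auto
next
  case False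
  then show ?thesis using up_gt[OF up_next[OF assms(1,2)], of "t - s"] semi[of s "t - s" x] assms by simp
qed

lemma up_strict_mono:
  assumes "up x" "0 \<le> s" "s < t" "S x s \<notin> Z"
  shows "S x s < S x t"
  using up_gt[OF up_next[OF assms(1,2,4)], of "t - s"] semi[of s "t - s" x] assms by simp

text \<open>A value strictly between y and a later position is passed and left again, so it is not
  stationary. This supplies room beyond any nonstationary point of an orbit.\<close>

lemma ex_later_not_Z:
  assumes "y \<notin> Z"
  shows "\<exists>\<delta>>0. S y \<delta> \<notin> Z"
proof -
  obtain e where e: "0 \<le> e" "S y e \<noteq> y" using assms by (auto simp: Z_def)
  define c where "c = (y + S y e) / 2"
  have c: "c \<noteq> y" "c \<noteq> S y e" using e by (auto simp: c_def field_simps)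
  have "y \<le> c \<and> c \<le> S y e \<or> S y e \<le> c \<and> c \<le> y" by (auto simp: c_def field_simps)
  then obtain \<delta> where d: "0 \<le> \<delta>" "\<delta> \<le> e" "S y \<delta> = c"
    using orbit_IVT[of 0 e y c] e(1) unfolding S0 by blast
  have "S y \<delta> \<notin> Z" using Z_absorbing[of y \<delta> e] d c by auto
  moreover have "0 < \<delta>" using d c by (cases "\<delta> = 0") auto
  ultimately show ?thesis by blast
qed

end

section \<open>Comparison of a semiflow with the flow built from its data\<close>

text \<open>Exactly what the data must satisfy for upward orbits to coincide with
  \<open>flow_right\<close>. It is interpreted twice, for S and for its mirror image, the latter
  covering downward orbits.\<close>

locale right_moving = flow_data f \<mu> Sg + real_flow S for f \<mu> Sg S +
  assumes sol: "caratheodory_sol f x (S x)"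
    and mu_orbit: "up x \<Longrightarrow> 0 \<le> q \<Longrightarrow> S x q \<notin> Z \<Longrightarrow>
      emeasure \<mu> {x..S x q} = emeasure lborel {t\<in>{0..q}. f (S x t) = 0}"
    and mu_stationary: "z \<in> Z \<Longrightarrow> z \<notin> Sg \<Longrightarrow> z < y \<Longrightarrow> emeasure \<mu> {z..y} = \<infinity>"
    and Sg_stationary: "Sg \<subseteq> Z"
begin

lemma N_stationary: "z \<in> Z \<Longrightarrow> z \<notin> Sg \<Longrightarrow> z < y \<Longrightarrow> emeasure N {z..y} = \<infinity>"
  by (simp add: emeasure_N mu_stationary)

lemma N_orbit:
  assumes "up x" "0 \<le> q" "S x q \<notin> Z"
  shows "emeasure N {x..S x q} = ennreal q"
proof -
  have "strict_mono_on {0..q} (S x)"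
    using up_strict_mono[OF assms(1)] not_Z_before[OF assms(3)] by (intro strict_mono_onI) auto
  then have "emeasure lborel {t\<in>{0..q}. f (S x t) = 0} + int_on {S x 0..S x q} (inv_fp f) = ennreal q"
    using sol[of x] by (intro solution_time[OF A1 assms(2)] cont) (auto simp: caratheodory_sol_def)
  then show ?thesis by (simp add: emeasure_N mu_orbit[OF assms])
qed

lemma orbit_passable:
  assumes "up x" "0 \<le> q" "S x q \<notin> Z"
  shows "passable x (S x q)"
proof -
  have "u \<notin> Sg" if "x \<le> u" "u \<le> S x q" for u
  proof -
    have "\<exists>r. 0 \<le> r \<and> r \<le> q \<and> S x r = u" using orbit_IVT[of 0 q x u] that assms(2) by simp
    then show ?thesis using not_Z_before[OF assms(3)] Sg_stationary by blast
  qed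
  moreover have "x \<le> S x q" using up_mono[of x 0 q] assms by simp
  ultimately show ?thesis using N_orbit[OF assms] by (auto simp: passable_def)
qed

lemma up_U_plus: "up x \<Longrightarrow> \<exists>y>x. passable x y"
  using ex_later_not_Z[OF up_not_Z] orbit_passable up_gt by (meson less_imp_le)

lemma Z_not_U_plus: "x \<in> Z \<Longrightarrow> \<not> (\<exists>y>x. passable x y)"
proof
  assume x: "x \<in> Z" and "\<exists>y>x. passable x y"
  then obtain y where y: "x < y" "passable x y" by blast
  then have "x \<notin> Sg" by (auto simp: passable_def disjoint_iff)
  then show False using N_stationary[OF x _ y(1)] y(2) by (simp add: passable_def)
qed

text \<open>If y is never reached, the orbit stays below y. It cannot stop there, since stationary
  points are not passable, so it moves below y forever, and N of [x,y] exceeds every time.\<close>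

lemma passable_reached:
  assumes "up x" "passable x y"
  shows "\<exists>r\<ge>0. S x r = y"
proof (rule ccontr)
  assume no: "\<not> (\<exists>r\<ge>0. S x r = y)"
  have xy: "x \<le> y" using assms by (simp add: passable_def)
  have lt: "S x t < y" if "0 \<le> t" for t
  proof (rule ccontr)
    assume "\<not> S x t < y"
    then have "\<exists>r. 0 \<le> r \<and> r \<le> t \<and> S x r = y" using orbit_IVT[of 0 t x y] that xy by simp
    then show False using no by blast
  qed
  have notZ: "S x t \<notin> Z" if "0 \<le> t" for t
  proof
    assume "S x t \<in> Z"
    moreover have "x \<le> S x t" using up_mono[OF assms(1), of 0 t] that by simp
    then have "passable (S x t) y" using lt[OF that] by (intro passable_right[OF assms(2)]) auto
    ultimately show False using Z_not_U_plus lt[OF that] by blast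
  qed
  obtain m where m: "0 \<le> m" "emeasure N {x..y} = ennreal m"
    using assms by (cases "emeasure N {x..y}") (auto simp: passable_def)
  \<comment> \<open>One time unit more than the supposed finite travel time m to y.\<close>
  have "emeasure N {x..S x (m + 1)} = ennreal (m + 1)"
    using N_orbit[OF assms(1)] notZ m by simp
  moreover have "emeasure N {x..S x (m + 1)} \<le> emeasure N {x..y}"
    using lt[of "m + 1"] m by (intro emeasure_mono) auto
  ultimately show False using m by simp
qed

text \<open>While the orbit is nonstationary, it continues strictly beyond S x t, which therefore
  lies before \<open>reach x\<close> and is found by its N-measure. Once stationary, it rests at
  \<open>reach x\<close>, and the travel time is already used up.\<close>

lemma flow_right_eq:
  assumes "up x" "0 \<le> t"
  shows "flow_right x t = S x t"
proof (cases "S x t \<in> Z")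
  case False
  let ?y = "S x t"
  obtain \<delta> where d: "0 < \<delta>" "S ?y \<delta> \<notin> Z" using ex_later_not_Z[OF False] by blast
  have eq: "S ?y \<delta> = S x (\<delta> + t)" using semi[of t \<delta> x] d assms by simp
  have "?y < S ?y \<delta>" using up_gt[OF up_next[OF assms False]] d by blast
  moreover have "passable x (S ?y \<delta>)"
    using orbit_passable[OF assms(1), of "\<delta> + t"] d assms(2) eq by simp
  then have "ereal (S ?y \<delta>) \<le> reach x" by (rule passable_le_reach)
  ultimately have "ereal ?y < reach x" by (metis less_ereal.simps(1) order_less_le_trans)
  moreover have "x \<le> ?y" using up_mono[of x 0 t] assms by simp
  ultimately show ?thesis using N_orbit[OF assms False] by (intro flow_right_unique) auto
next
  case True
  let ?r = "S x t"
  have ex: "\<exists>y>x. passable x y" by (rule up_U_plus[OF assms(1)])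
  have below: "S x s \<le> ?r" "s \<le> t \<or> S x s = ?r" if "0 \<le> s" for s
    using up_mono[OF assms(1), of s t] Z_absorbing[OF True assms(2), of s] that linear[of s t] by auto
  have before: "\<exists>s. 0 \<le> s \<and> s \<le> t \<and> S x s = z \<and> z \<notin> Z" if z: "x \<le> z" "z < ?r" for z
  proof -
    obtain s where s: "0 \<le> s" "s \<le> t" "S x s = z"
      using orbit_IVT[of 0 t x z] z(1) less_imp_le[OF z(2)] assms(2) unfolding S0 by blast
    then have "z \<notin> Z" using Z_absorbing[of x s t] z by auto
    then show ?thesis using s by blast
  qed
  \<comment> \<open>Passable points are reached and hence lie below the resting point; conversely
    every point before the resting point is passed while nonstationary, hence passable.\<close>
  have reach: "reach x = ereal ?r"
  proof (rule antisym)
    show "reach x \<le> ereal ?r"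
      unfolding reach_def
    proof (rule SUP_least)
      fix y assume "y \<in> {y. passable x y}"
      then obtain s where "0 \<le> s" "S x s = y" using passable_reached[OF assms(1)] by auto
      then show "ereal y \<le> ereal ?r" using below by auto
    qed
    show "ereal ?r \<le> reach x"
    proof (rule dense_le)
      fix a assume a: "a < ereal ?r"
      show "a \<le> reach x"
      proof (cases "a \<le> ereal x")
        case True
        then show ?thesis using reach_gt[OF ex] by simp
      next
        case False
        then obtain z where z: "a = ereal z" "x \<le> z" "z < ?r" using a by (cases a) auto
        then obtain s where "0 \<le> s" "S x s = z" "z \<notin> Z" using before by blast
        then show ?thesis using orbit_passable[OF assms(1)] passable_le_reach z by blast
      qed
    qed
  qed
  have "\<not> ennreal t < travel_time x"
  proof
    assume "ennreal t < travel_time x"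
    then obtain z where z: "x \<le> z" "z < ?r" "ennreal t < emeasure N {x..z}"
      unfolding travel_time_gt[OF ex] reach by auto
    obtain s where s: "0 \<le> s" "s \<le> t" "S x s = z" "z \<notin> Z" using before[OF z(1,2)] by blast
    then have "emeasure N {x..z} = ennreal s" using N_orbit[OF assms(1) s(1)] by simp
    then show False using z(3) s assms(2) by (simp add: ennreal_less_iff)
  qed
  then show ?thesis using reach by (simp add: flow_right_def)
qed

end

section \<open>The clock measure of a semiflow\<close>

context real_flow
begin

text \<open>Orbits of both directions are clocked here, so measurability comes from continuity
  instead of monotonicity.\<close>

lemma clamp_orbit_measurable: "0 \<le> q \<Longrightarrow> clamp_path q (S x) \<in> borel_measurable borel"
  unfolding clamp_path_def
  by (intro borel_measurable_continuous_onI continuous_on_compose2[OF cont[of q x]] continuous_intros) auto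

lemma emeasure_occupation_orbit:
  "0 \<le> q \<Longrightarrow> A \<in> sets borel \<Longrightarrow> emeasure (occupation q (S x)) A = emeasure lborel {t\<in>{0..q}. S x t \<in> A}"
  by (rule emeasure_occupation[OF clamp_orbit_measurable])

text \<open>If neither orbit passes through the start of the other, the intermediate value theorem
  places the starting points on opposite sides of the meeting point. One orbit arrives rising and
  the other falling, and each direction persists, so the meeting point would move both up and
  down.\<close>

lemma orbits_meet:
  assumes s: "0 \<le> s" "0 \<le> s'" and y: "S x s = S x' s'" "S x s \<notin> Z"
  shows "(\<exists>u\<ge>0. u \<le> s \<and> S x u = x') \<or> (\<exists>u\<ge>0. u \<le> s' \<and> S x' u = x)"
proof (rule ccontr)
  assume no: "\<not> ?thesis"
  have n1: "\<not> (x \<le> x' \<and> x' \<le> S x s \<or> S x s \<le> x' \<and> x' \<le> x)"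
    using orbit_IVT[of 0 s x x'] s(1) no unfolding S0 by blast
  have n2: "\<not> (x' \<le> x \<and> x \<le> S x s \<or> S x s \<le> x \<and> x \<le> x')"
    using orbit_IVT[of 0 s' x' x] s(2) no unfolding S0 y(1) by blast
  have dir: "up z" if "z < S z r" "0 \<le> r" for z r
    using that by (cases "r = 0") (auto simp: up_def intro!: exI[of _ r])
  have dir': "down z" if "S z r < z" "0 \<le> r" for z r
    using that by (cases "r = 0") (auto simp: down_def intro!: exI[of _ r])
  have clash: False if "a < S a r" "S b r' < b" "0 \<le> r" "0 \<le> r'" "S a r = S b r'" "S a r \<notin> Z" for a b r r'
  proof -
    have "up (S a r)" using up_next[OF dir] that by blast
    moreover have "down (S a r)"
    proof -
      interpret R: real_flow "\<lambda>x t. - S (- x) t" by (rule reflect_flow)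
      have "R.up (- b)" unfolding R.up_def using dir'[OF that(2,4)] by (auto simp: down_def)
      moreover have "- S (- (- b)) r' \<notin> R.Z" using that(5,6) by (auto simp: R.Z_def Z_def)
      ultimately have "R.up (- S (- (- b)) r')" using R.up_next that(4) by blast
      then show ?thesis using that(5) by (auto simp: R.up_def down_def)
    qed
    ultimately show False using up_not_down by blast
  qed
  have "x < S x s \<and> S x s < x' \<or> x' < S x s \<and> S x s < x" using n1 n2 by linarith
  then show False
  proof
    assume "x < S x s \<and> S x s < x'"
    then show False by (intro clash[of x s x' s']) (simp_all add: s y(1) y(2)[unfolded y(1)])
  next
    assume "x' < S x s \<and> S x s < x"
    then show False by (intro clash[of x' s' x s]) (simp_all add: s y(1) y(2)[unfolded y(1)])
  qed
qed

text \<open>By \<open>orbits_meet\<close> one orbit is the tail of the other after a delay u.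
  Nonstationary points are visited only once, so the two sets of visiting times are translates of
  each other by u.\<close>

lemma occupation_consistent:
  assumes "0 \<le> q" "S x q \<notin> Z" "0 \<le> q'" "S x' q' \<notin> Z"
    and A: "A \<in> sets borel" "A \<subseteq> S x ` {0..q}" "A \<subseteq> S x' ` {0..q'}"
  shows "emeasure (occupation q (S x)) A = emeasure (occupation q' (S x')) A"
proof -
  have shift: "emeasure lborel {t\<in>{0..q}. S x t \<in> A} = emeasure lborel {t\<in>{0..q'}. S x' t \<in> A}"
    if "0 \<le> u" "S x u = x'" "0 \<le> q" "S x q \<notin> Z" "0 \<le> q'" "S x' q' \<notin> Z"
      "A \<subseteq> S x ` {0..q}" "A \<subseteq> S x' ` {0..q'}" for x x' q q' u
  proof -
    have bm: "{t\<in>{0..q}. S x t \<in> A} \<in> sets borel"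
    proof -
      have "clamp_path q (S x) -` A \<in> sets borel"
        using measurable_sets_borel[OF clamp_orbit_measurable[OF that(3)] A(1)] .
      then have "{0..q} \<inter> clamp_path q (S x) -` A \<in> sets borel" by simp
      also have "{0..q} \<inter> clamp_path q (S x) -` A = {t\<in>{0..q}. S x t \<in> A}" by (auto simp: clamp_path_eq)
      finally show ?thesis .
    qed
    have Sx: "S x' t = S x (t + u)" if "0 \<le> t" for t using semi[of u t x] \<open>0 \<le> u\<close> \<open>S x u = x'\<close> that by simp
    have notZ: "a \<notin> Z" if "a \<in> A" for a
      using that \<open>A \<subseteq> S x ` {0..q}\<close> not_Z_before[OF \<open>S x q \<notin> Z\<close>] by auto
    have "(+) u -` {t\<in>{0..q}. S x t \<in> A} = {t\<in>{0..q'}. S x' t \<in> A}"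
    proof (intro set_eqI iffI)
      fix t assume "t \<in> (+) u -` {t\<in>{0..q}. S x t \<in> A}"
      then have t: "0 \<le> u + t" "u + t \<le> q" "S x (u + t) \<in> A" by auto
      from t(3) have "S x (u + t) \<in> S x' ` {0..q'}" using \<open>A \<subseteq> S x' ` {0..q'}\<close> by blast
      then obtain t' where t': "0 \<le> t'" "t' \<le> q'" "S x (u + t) = S x' t'" by auto
      have "u + t = t' + u"
        by (rule orbit_inj[of _ _ x]) (use t t' Sx notZ \<open>0 \<le> u\<close> in auto)
      then show "t \<in> {t\<in>{0..q'}. S x' t \<in> A}" using t t' by auto
    next
      fix t assume "t \<in> {t\<in>{0..q'}. S x' t \<in> A}"
      then have t: "0 \<le> t" "t \<le> q'" "S x' t \<in> A" by auto
      from t(3) have "S x' t \<in> S x ` {0..q}" using \<open>A \<subseteq> S x ` {0..q}\<close> by blast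
      then obtain r where r: "0 \<le> r" "r \<le> q" "S x r = S x' t" by auto
      have "r = t + u"
        by (rule orbit_inj[of _ _ x]) (use t r Sx notZ \<open>0 \<le> u\<close> in auto)
      then show "t \<in> (+) u -` {t\<in>{0..q}. S x t \<in> A}" using t r \<open>0 \<le> u\<close> by (auto simp: add.commute)
    qed
    moreover have "emeasure lborel {t\<in>{0..q}. S x t \<in> A}
        = emeasure (distr lborel borel ((+) u)) {t\<in>{0..q}. S x t \<in> A}"
      by (simp only: lborel_distr_plus)
    moreover have "\<dots> = emeasure lborel ((+) u -` {t\<in>{0..q}. S x t \<in> A})"
      by (subst emeasure_distr[OF _ bm]) simp_all
    ultimately show ?thesis by simp
  qed
  show ?thesis
  proof (cases "A = {}")
    case False
    then obtain y where "y \<in> A" by blast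
    then have "y \<in> S x ` {0..q}" "y \<in> S x' ` {0..q'}" using A(2,3) by blast+
    then obtain s s' where s: "0 \<le> s" "s \<le> q" "0 \<le> s'" "s' \<le> q'" "S x s = S x' s'" by auto
    have "S x s \<notin> Z" using not_Z_before[OF assms(2)] s by blast
    from orbits_meet[OF s(1,3,5) this]
    show ?thesis
    proof
      assume "\<exists>u\<ge>0. u \<le> s \<and> S x u = x'"
      then obtain u where "0 \<le> u" "S x u = x'" by blast
      from shift[OF this assms(1-4) A(2,3)] show ?thesis
        using assms(1,3) A(1) by (simp add: emeasure_occupation_orbit)
    next
      assume "\<exists>u\<ge>0. u \<le> s' \<and> S x' u = x"
      then obtain u where "0 \<le> u" "S x' u = x" by blast
      from shift[OF this assms(3,4,1,2) A(3,2)] show ?thesis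
        using assms(1,3) A(1) by (simp add: emeasure_occupation_orbit)
    qed
  qed simp
qed

text \<open>Orbit segments with rational start and rational duration are countably many and are made
  disjoint. Their occupation measures are summed; consistency makes the sum agree with the clock of
  any orbit on its nonstationary part.\<close>

lemma ex_clock_measure:
  assumes B: "B \<in> sets borel" "Z \<subseteq> B"
  shows "\<exists>\<mu>. sets \<mu> = sets borel \<and> (\<forall>x. emeasure \<mu> {x} = 0) \<and> emeasure \<mu> (UNIV - B) = 0 \<and>
    (\<forall>A\<in>sets borel. uncountable (A \<inter> Z) \<longrightarrow> emeasure \<mu> A = \<infinity>) \<and>
    (\<forall>x q A. 0 \<le> q \<longrightarrow> S x q \<notin> Z \<longrightarrow> A \<in> sets borel \<longrightarrow> A \<subseteq> S x ` {0..q} \<longrightarrow>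
      emeasure \<mu> A = emeasure (occupation q (S x)) (B \<inter> A))"
proof -
  \<comment> \<open>k codes a pair of rationals: the start \<open>r k\<close> and the duration
    \<open>p k\<close>.\<close>
  define r where "r k = real_of_rat (fst (from_nat k :: rat \<times> rat))" for k
  define p where "p k = real_of_rat (snd (from_nat k :: rat \<times> rat))" for k
  \<comment> \<open>Segments ending in a stationary point are dropped: there the time of a visit is
    not unique and \<open>occupation_consistent\<close> does not apply.\<close>
  define F where "F k = (if 0 \<le> p k \<and> S (r k) (p k) \<notin> Z then S (r k) ` {0..p k} else {})" for k
  define E where "E = disjointed F"
  have F: "F k \<in> sets borel" for k
    unfolding F_def using compact_continuous_image[OF cont compact_Icc] by (auto intro: borel_compact)
  then have E [measurable]: "E k \<in> sets borel" for k
    using sets.range_disjointed_sets[of F borel] unfolding E_def by auto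
  have dE: "disjoint_family E" unfolding E_def by (rule disjoint_family_disjointed)
  have UE: "(\<Union>k. E k) = (\<Union>k. F k)" unfolding E_def by (rule UN_disjointed_eq)
  have EF: "E k \<subseteq> F k" for k unfolding E_def by (rule disjointed_subset)
  note B(1)[measurable]
  define W where "W k = density (occupation (p k) (S (r k))) (indicator (B \<inter> E k))" for k
  have W: "emeasure (W k) A = emeasure (occupation (p k) (S (r k))) (B \<inter> E k \<inter> A)" if "A \<in> sets borel" for k A
    using that unfolding W_def by (simp add: emeasure_density indicator_inter_arith[symmetric])
  \<comment> \<open>The second summand is additive because a countable union of countable sets is
    countable, and it vanishes on singletons, which keeps the measure atomless.\<close>
  define m where "m A = (\<Sum>k. emeasure (W k) A) + (if countable (A \<inter> Z) then 0 else \<infinity>)" for A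
  have swap: "(\<Sum>k. \<Sum>i. a k i) = (\<Sum>i. \<Sum>k. a k i)" for a :: "nat \<Rightarrow> nat \<Rightarrow> ennreal"
    using nn_integral_suminf[of "\<lambda>i k. a k i" "count_space UNIV"] by (simp add: nn_integral_count_space_nat)
  have "\<exists>M. sets M = sets borel \<and> (\<forall>A\<in>sets borel. emeasure M A = m A)"
  proof (rule ex_borel_measure)
    fix A :: "nat \<Rightarrow> real set" assume A: "range A \<subseteq> sets borel" "disjoint_family A"
    have "emeasure (W k) (\<Union>i. A i) = (\<Sum>i. emeasure (W k) (A i))" for k
      using A by (intro suminf_emeasure[symmetric]) (auto simp: W_def)
    then have 1: "(\<Sum>k. emeasure (W k) (\<Union>i. A i)) = (\<Sum>i. \<Sum>k. emeasure (W k) (A i))"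
      using swap[of "\<lambda>k i. emeasure (W k) (A i)"] by simp
    have 2: "(if countable ((\<Union>i. A i) \<inter> Z) then 0 else \<infinity>) = (\<Sum>i. if countable (A i \<inter> Z) then 0 else \<infinity> :: ennreal)"
    proof (cases "\<forall>i. countable (A i \<inter> Z)")
      case True
      then have "countable (\<Union>i. A i \<inter> Z)" by blast
      then have "countable ((\<Union>i. A i) \<inter> Z)" by (rule countable_subset[rotated]) blast
      then show ?thesis using True by simp
    next
      case False
      then obtain i where i: "uncountable (A i \<inter> Z)" by blast
      then have "uncountable ((\<Union>i. A i) \<inter> Z)" using countable_subset[of "A i \<inter> Z" "(\<Union>i. A i) \<inter> Z"] by blast
      moreover have "(\<Sum>i. if countable (A i \<inter> Z) then 0 else \<infinity> :: ennreal) \<ge> \<infinity>"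
        using sum_le_suminf[of "\<lambda>i. if countable (A i \<inter> Z) then 0 else \<infinity> :: ennreal" "{i}"] i by simp
      ultimately show ?thesis by (simp add: top_unique)
    qed
    show "m (\<Union>i. A i) = (\<Sum>i. m (A i))"
      unfolding m_def 1 2 by (simp add: suminf_add)
  qed (simp add: m_def)
  then obtain \<mu> where \<mu>: "sets \<mu> = sets borel" "\<And>A. A \<in> sets borel \<Longrightarrow> emeasure \<mu> A = m A" by blast
  have "emeasure \<mu> {x} = 0" for x
  proof -
    have "emeasure (W k) {x} = 0" for k
    proof (cases "x \<in> E k")
      case False
      then have none: "B \<inter> E k \<inter> {x} = {}" by auto
      have "emeasure (W k) {x} = emeasure (occupation (p k) (S (r k))) (B \<inter> E k \<inter> {x})" by (rule W) simp
      then show ?thesis unfolding none by simp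
    next
      case True
      then have "x \<in> F k" using EF by blast
      then have k: "0 \<le> p k" "S (r k) (p k) \<notin> Z" "x \<in> S (r k) ` {0..p k}" by (auto simp: F_def split: if_splits)
      then obtain t0 where t0: "0 \<le> t0" "t0 \<le> p k" "x = S (r k) t0" by auto
      have "{t\<in>{0..p k}. S (r k) t \<in> B \<inter> E k \<inter> {x}} \<subseteq> {t0}"
      proof
        fix t assume "t \<in> {t\<in>{0..p k}. S (r k) t \<in> B \<inter> E k \<inter> {x}}"
        then have "t0 = t"
          using t0 not_Z_before[OF k(2) t0(1,2)] by (intro orbit_inj[of t0 t "r k"]) auto
        then show "t \<in> {t0}" by simp
      qed
      then have "countable {t\<in>{0..p k}. S (r k) t \<in> B \<inter> E k \<inter> {x}}" by (rule countable_subset) simp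
      then have "emeasure lborel {t\<in>{0..p k}. S (r k) t \<in> B \<inter> E k \<inter> {x}} = 0"
        by (rule emeasure_lborel_countable)
      moreover have "emeasure (W k) {x} = emeasure (occupation (p k) (S (r k))) (B \<inter> E k \<inter> {x})" by (rule W) simp
      moreover have "\<dots> = emeasure lborel {t\<in>{0..p k}. S (r k) t \<in> B \<inter> E k \<inter> {x}}"
        by (rule emeasure_occupation_orbit[OF k(1)]) simp
      ultimately show ?thesis by simp
    qed
    then show ?thesis by (simp add: \<mu>(2) m_def)
  qed
  moreover have "emeasure \<mu> (UNIV - B) = 0"
  proof -
    have none: "B \<inter> E k \<inter> (UNIV - B) = {}" for k by auto
    have "emeasure (W k) (UNIV - B) = emeasure (occupation (p k) (S (r k))) (B \<inter> E k \<inter> (UNIV - B))" for k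
      by (rule W) simp
    then have "emeasure (W k) (UNIV - B) = 0" for k unfolding none by simp
    moreover have "(UNIV - B) \<inter> Z = {}" using B(2) by auto
    ultimately show ?thesis using \<mu>(2)[of "UNIV - B"] by (simp add: m_def)
  qed
  moreover have "emeasure \<mu> A = \<infinity>" if "A \<in> sets borel" "uncountable (A \<inter> Z)" for A
    using that by (simp add: \<mu>(2) m_def)
  moreover have "emeasure \<mu> A = emeasure (occupation q (S x)) (B \<inter> A)"
    if q: "0 \<le> q" "S x q \<notin> Z" and A [measurable]: "A \<in> sets borel" and sub: "A \<subseteq> S x ` {0..q}" for x q A
  proof -
    let ?O = "occupation q (S x)"
    have "A \<inter> Z = {}" using sub not_Z_before[OF q(2)] by auto
    then have "emeasure \<mu> A = (\<Sum>k. emeasure (W k) A)" by (simp add: \<mu>(2) m_def)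
    also have "\<dots> = (\<Sum>k. emeasure ?O (B \<inter> E k \<inter> A))"
    proof (rule suminf_cong)
      fix k
      show "emeasure (W k) A = emeasure ?O (B \<inter> E k \<inter> A)"
      proof (cases "0 \<le> p k \<and> S (r k) (p k) \<notin> Z")
        case True
        then have "E k \<subseteq> S (r k) ` {0..p k}" using EF[of k] by (simp add: F_def)
        then have "emeasure (occupation (p k) (S (r k))) (B \<inter> E k \<inter> A) = emeasure ?O (B \<inter> E k \<inter> A)"
          using True q sub by (intro occupation_consistent) auto
        then show ?thesis by (simp add: W)
      next
        case False
        then have "E k = {}" using EF[of k] by (auto simp: F_def)
        then show ?thesis by (simp add: W)
      qed
    qed
    also have "\<dots> = emeasure ?O (\<Union>k. B \<inter> E k \<inter> A)"
      using dE by (intro suminf_emeasure) (auto simp: disjoint_family_on_def)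
    also have "\<dots> = emeasure ?O (B \<inter> A)"
    proof (rule antisym)
      show "emeasure ?O (\<Union>k. B \<inter> E k \<inter> A) \<le> emeasure ?O (B \<inter> A)" by (intro emeasure_mono) auto
      \<comment> \<open>A rational a strictly between x and S x t lies on the orbit, at some time u.
        A rational duration slightly above t - u takes it past S x t, the slack
        \<open>\<delta>\<close> keeping its end nonstationary.\<close>
      have cover: "\<exists>k. S x t \<in> F k" if t: "0 < t" "t \<le> q" for t
      proof -
        let ?y = "S x t"
        have y: "?y \<notin> Z" "x \<notin> Z" using not_Z_before[OF q(2)] not_Z_before[OF q(2), of 0] t q by auto
        then have "x \<noteq> ?y" using orbit_inj[of 0 t x] t by auto
        then obtain a where a: "x < real_of_rat a \<and> real_of_rat a < ?y \<or> ?y < real_of_rat a \<and> real_of_rat a < x"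
          using of_rat_dense[of x ?y] of_rat_dense[of ?y x] by (meson linorder_neqE_linordered_idom)
        have "x \<le> real_of_rat a \<and> real_of_rat a \<le> ?y \<or> ?y \<le> real_of_rat a \<and> real_of_rat a \<le> x" using a by auto
        then obtain u where u: "0 \<le> u" "u \<le> t" "S x u = real_of_rat a"
          using orbit_IVT[of 0 t x "real_of_rat a"] t unfolding S0 by auto
        obtain \<delta> where d: "0 < \<delta>" "S ?y \<delta> \<notin> Z" using ex_later_not_Z[OF y(1)] by blast
        obtain b where b: "t - u < real_of_rat b" "real_of_rat b < t - u + \<delta>"
          using of_rat_dense[of "t - u" "t - u + \<delta>"] d by auto
        have Sa: "S (real_of_rat a) \<tau> = S x (\<tau> + u)" if "0 \<le> \<tau>" for \<tau> using semi[of u \<tau> x] u that by simp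
        have "S (real_of_rat a) (t - u + \<delta>) = S ?y \<delta>" using Sa[of "t - u + \<delta>"] semi[of t \<delta> x] u d t by (simp add: add.commute)
        then have "S (real_of_rat a) (t - u + \<delta>) \<notin> Z" using d by simp
        moreover have b0: "0 \<le> real_of_rat b" "real_of_rat b \<le> t - u + \<delta>" using b u by linarith+
        ultimately have nz: "S (real_of_rat a) (real_of_rat b) \<notin> Z" by (rule not_Z_before)
        have "S (real_of_rat a) (t - u) = ?y" using Sa[of "t - u"] u by simp
        moreover have "t - u \<in> {0..real_of_rat b}" using u b by auto
        ultimately have "?y \<in> S (real_of_rat a) ` {0..real_of_rat b}" by (metis image_eqI)
        then have "?y \<in> F (to_nat (a, b))" using nz b0(1) by (simp add: F_def r_def p_def)
        then show ?thesis by blast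
      qed
      \<comment> \<open>Only the starting point of the orbit may be missed, since the covering needs
        t > 0; a single instant is null.\<close>
      have "{t\<in>{0..q}. S x t \<in> B \<inter> A - (\<Union>k. E k)} \<subseteq> {0}"
      proof
        fix t assume "t \<in> {t\<in>{0..q}. S x t \<in> B \<inter> A - (\<Union>k. E k)}"
        then have "0 \<le> t" "t \<le> q" "\<not> (\<exists>k. S x t \<in> F k)" using UE by auto
        then have "\<not> 0 < t" using cover by blast
        then show "t \<in> {0}" using \<open>0 \<le> t\<close> by simp
      qed
      then have "countable {t\<in>{0..q}. S x t \<in> B \<inter> A - (\<Union>k. E k)}" by (rule countable_subset) simp
      then have "emeasure lborel {t\<in>{0..q}. S x t \<in> B \<inter> A - (\<Union>k. E k)} = 0"
        by (rule emeasure_lborel_countable)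
      then have null: "emeasure ?O (B \<inter> A - (\<Union>k. E k)) = 0"
        by (subst emeasure_occupation_orbit[OF q(1)]) simp_all
      have "emeasure ?O (B \<inter> A) \<le> emeasure ?O ((\<Union>k. B \<inter> E k \<inter> A) \<union> (B \<inter> A - (\<Union>k. E k)))"
        by (intro emeasure_mono) auto
      also have "\<dots> \<le> emeasure ?O (\<Union>k. B \<inter> E k \<inter> A) + emeasure ?O (B \<inter> A - (\<Union>k. E k))"
        by (intro emeasure_subadditive) auto
      finally show "emeasure ?O (B \<inter> A) \<le> emeasure ?O (\<Union>k. B \<inter> E k \<inter> A)" by (simp add: null)
    qed
    finally show ?thesis .
  qed
  ultimately show ?thesis using \<mu>(1) by blast
qed

end

section \<open>Semigroups are constructed\<close>

text \<open>Replace y by a rational q. Of two such points z < w for the same q, the larger one lies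
  in a countable set Z intersected with [r,q] for a rational r between them. So all of
  \<open>A q\<close> except possibly its smallest point lies in the countable set
  \<open>G q\<close>.\<close>

lemma countable_right_isolated:
  fixes Z :: "real set"
  shows "countable {z\<in>Z. \<exists>y>z. countable (Z \<inter> {z..y})}"
proof -
  define G where "G q = (\<Union>r\<in>{r::rat. countable (Z \<inter> {of_rat r..q})}. Z \<inter> {of_rat r..q})" for q :: real
  define A where "A q = {z\<in>Z. z \<le> q \<and> countable (Z \<inter> {z..q})}" for q :: real
  have G: "countable (G q)" for q unfolding G_def by (intro countable_UN) auto
  have step: "w \<in> G q" if "z \<in> A q" "w \<in> A q" "z < w" for z w q
  proof -
    obtain r where r: "z < of_rat r" "of_rat r < w" using of_rat_dense[OF \<open>z < w\<close>] by blast
    have "countable (Z \<inter> {of_rat r..q})"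
      by (rule countable_subset[of _ "Z \<inter> {z..q}"]) (use that r in \<open>auto simp: A_def\<close>)
    then show ?thesis unfolding G_def using that r by (auto simp: A_def intro!: exI[of _ r])
  qed
  have A: "countable (A q)" for q
  proof (cases "A q \<subseteq> G q")
    case True
    then show ?thesis using G countable_subset by blast
  next
    case False
    then obtain z where z: "z \<in> A q" "z \<notin> G q" by blast
    have "A q \<subseteq> insert z (G q)"
    proof
      fix w assume w: "w \<in> A q"
      consider "w = z" | "z < w" | "w < z" by linarith
      then show "w \<in> insert z (G q)"
      proof cases
        case 2 then show ?thesis using step[OF z(1) w] by blast
      next
        case 3 then show ?thesis using step[OF w z(1)] z(2) by blast
      qed simp
    qed
    then show ?thesis by (rule countable_subset) (simp add: G)
  qed
  have "{z\<in>Z. \<exists>y>z. countable (Z \<inter> {z..y})} \<subseteq> (\<Union>q::rat. A (of_rat q))"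
  proof
    fix z assume "z \<in> {z\<in>Z. \<exists>y>z. countable (Z \<inter> {z..y})}"
    then obtain y where y: "z \<in> Z" "z < y" "countable (Z \<inter> {z..y})" by blast
    obtain q where q: "z < of_rat q" "of_rat q < y" using of_rat_dense[OF y(2)] by blast
    have "countable (Z \<inter> {z..of_rat q})"
      by (rule countable_subset[OF _ y(3)]) (use q in auto)
    then have "z \<in> A (of_rat q)" using y q by (simp add: A_def)
    then show "z \<in> (\<Union>q::rat. A (of_rat q))" by blast
  qed
  then show ?thesis by (rule countable_subset) (simp add: A)
qed

lemma countable_left_isolated:
  fixes Z :: "real set"
  shows "countable {z\<in>Z. \<exists>y<z. countable (Z \<inter> {y..z})}"
proof -
  have "{z\<in>Z. \<exists>y<z. countable (Z \<inter> {y..z})}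
      \<subseteq> uminus ` {z\<in>uminus ` Z. \<exists>y>z. countable (uminus ` Z \<inter> {z..y})}"
  proof
    fix z assume "z \<in> {z\<in>Z. \<exists>y<z. countable (Z \<inter> {y..z})}"
    then obtain y where y: "z \<in> Z" "y < z" "countable (Z \<inter> {y..z})" by blast
    have "uminus ` (Z \<inter> {y..z}) = uminus ` Z \<inter> {- z..- y}"
      by (simp add: image_Int)
    then have "countable (uminus ` Z \<inter> {- z..- y})" using countable_image[OF y(3), of uminus] by simp
    moreover have "- z < - y" using y(2) by simp
    ultimately have "- z \<in> {z\<in>uminus ` Z. \<exists>y>z. countable (uminus ` Z \<inter> {z..y})}" using y(1) by blast
    then show "z \<in> uminus ` {z\<in>uminus ` Z. \<exists>y>z. countable (uminus ` Z \<inter> {z..y})}"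
      by (simp only: mem_uminus_image)
  qed
  then show ?thesis by (rule countable_subset) (intro countable_image countable_right_isolated)
qed

text \<open>Orbits are indefinite integrals, hence continuous in time.\<close>

lemma det_semigroup_real_flow:
  assumes "det_semigroup f S"
  shows "real_flow S"
proof
  show "S x 0 = x" "0 \<le> s \<Longrightarrow> 0 \<le> t \<Longrightarrow> S (S x s) t = S x (t + s)" for x s t
    using assms by (auto simp: det_semigroup_def)
  fix T x
  show "continuous_on {0..T} (S x)"
  proof (cases "0 \<le> T")
    case True
    have i: "((\<lambda>s. f (S x s)) has_integral (S x t - x)) {0..t}" if "0 \<le> t" for t
      using assms that by (simp add: det_semigroup_def caratheodory_sol_def)
    then have "(\<lambda>s. f (S x s)) integrable_on {0..T}" using True by blast
    then have "continuous_on {0..T} (\<lambda>t. x + integral {0..t} (\<lambda>s. f (S x s)))"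
      by (intro continuous_intros indefinite_integral_continuous_1)
    moreover have "x + integral {0..t} (\<lambda>s. f (S x s)) = S x t" if "t \<in> {0..T}" for t
      using integral_unique[OF i[of t]] that by simp
    ultimately show ?thesis by (rule continuous_on_eq)
  qed simp
qed

theorem det_semigroup_ex_construction:
  assumes A1: "A1 f" and S: "det_semigroup f S"
  shows "\<exists>\<mu> Sg \<Phi>. flow_data f \<mu> Sg \<and> countable Sg \<and> (\<forall>x. \<Phi> x \<in> {-1, 1 :: int}) \<and>
    (\<forall>x t. 0 \<le> t \<longrightarrow> S x t = constructed_semigroup f \<mu> Sg \<Phi> x t)"
proof -
  interpret real_flow S using S by (rule det_semigroup_real_flow)
  have sol: "caratheodory_sol f x (S x)" for x using S by (simp add: det_semigroup_def)
  define B where "B = f -` {0}"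
  have B: "B \<in> sets borel" unfolding B_def by (rule measurable_sets_borel[OF A1_measurable[OF A1]]) simp
  have ZB: "Z \<subseteq> B"
  proof
    fix x assume x: "x \<in> Z"
    have "((\<lambda>s. f (S x s)) has_integral (S x 1 - x)) {0..1}"
      using sol[of x] by (simp add: caratheodory_sol_def)
    then have "((\<lambda>s. f (S x s)) has_integral 0) {0..1}"
      using Z_fixed[OF x, of 1] by simp
    then have "((\<lambda>s. f x) has_integral 0) {0..1::real}"
      by (rule has_integral_eq[rotated]) (use Z_fixed[OF x] in simp)
    moreover have "((\<lambda>s. f x) has_integral (f x)) {0..1::real}"
      using has_integral_const_real[of "f x" 0 1] by simp
    ultimately have "0 = f x" by (rule has_integral_unique)
    then show "x \<in> B" by (simp add: B_def)
  qed
  obtain \<mu> where \<mu>: "sets \<mu> = sets borel" "\<And>x. emeasure \<mu> {x} = 0" "emeasure \<mu> (UNIV - B) = 0"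
    and unc: "\<And>A. A \<in> sets borel \<Longrightarrow> uncountable (A \<inter> Z) \<Longrightarrow> emeasure \<mu> A = \<infinity>"
    and occ: "\<And>x q A. 0 \<le> q \<Longrightarrow> S x q \<notin> Z \<Longrightarrow> A \<in> sets borel \<Longrightarrow> A \<subseteq> S x ` {0..q} \<Longrightarrow>
      emeasure \<mu> A = emeasure (occupation q (S x)) (B \<inter> A)"
    using ex_clock_measure[OF B ZB] by metis
  \<comment> \<open>Both sides are needed: a stationary point outside Sg has uncountably many
    stationary points on its right, blocking the flow to the right, and on its left, blocking the
    mirrored flow.\<close>
  define Sg where "Sg = {z\<in>Z. \<exists>y>z. countable (Z \<inter> {z..y})} \<union> {z\<in>Z. \<exists>y<z. countable (Z \<inter> {y..z})}"
  have cSg: "countable Sg"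
    unfolding Sg_def by (intro countable_Un countable_right_isolated countable_left_isolated)
  have SgZ: "Sg \<subseteq> Z" by (auto simp: Sg_def)
  have seg: "{a..b} \<subseteq> S x ` {0..q}" if q: "0 \<le> q" "x = a \<and> S x q = b \<or> x = b \<and> S x q = a" for x q a b
  proof
    fix c assume "c \<in> {a..b}"
    then have "x \<le> c \<and> c \<le> S x q \<or> S x q \<le> c \<and> c \<le> x" using q(2) by auto
    then obtain u where "0 \<le> u" "u \<le> q" "S x u = c" using orbit_IVT[of 0 q x c] q(1) unfolding S0 by blast
    then show "c \<in> S x ` {0..q}" by auto
  qed
  \<comment> \<open>Stated for both orientations of the orbit; the second serves the mirrored
    interpretation.\<close>
  have occ_seg: "emeasure \<mu> {a..b} = emeasure lborel {t\<in>{0..q}. f (S x t) = 0 \<and> S x t \<in> {a..b}}"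
    if "0 \<le> q" "S x q \<notin> Z" "x = a \<and> S x q = b \<or> x = b \<and> S x q = a" for x q a b
    using occ[OF that(1,2) _ seg[OF that(1,3)]] emeasure_occupation_orbit[OF that(1), of "B \<inter> {a..b}" x] B
    by (simp add: B_def conj_commute)
  have data: "flow_data f \<mu> Sg"
    using A1 \<mu> SgZ ZB by unfold_locales (auto simp: B_def)
  interpret right_moving f \<mu> Sg S
  proof (intro right_moving.intro data real_flow_axioms right_moving_axioms.intro)
    show "caratheodory_sol f x (S x)" for x by (rule sol)
    show "Sg \<subseteq> Z" by (rule SgZ)
    show "emeasure \<mu> {z..y} = \<infinity>" if "z \<in> Z" "z \<notin> Sg" "z < y" for z y
    proof (rule unc)
      have "uncountable (Z \<inter> {z..y})" using that unfolding Sg_def by blast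
      then show "uncountable ({z..y} \<inter> Z)" by (simp add: Int_commute)
    qed simp
    fix x q assume x: "up x" "0 \<le> q" "S x q \<notin> Z"
    have "{t\<in>{0..q}. f (S x t) = 0 \<and> S x t \<in> {x..S x q}} = {t\<in>{0..q}. f (S x t) = 0}"
      using up_mono[OF x(1), of 0] up_mono[OF x(1), of _ q] by auto
    then show "emeasure \<mu> {x..S x q} = emeasure lborel {t\<in>{0..q}. f (S x t) = 0}"
      using occ_seg[OF x(2,3), of x "S x q"] by simp
  qed
  interpret RF: real_flow "\<lambda>x t. - S (- x) t" by (rule reflect_flow)
  have RZ: "z \<in> RF.Z \<longleftrightarrow> - z \<in> Z" for z by (auto simp: RF.Z_def Z_def minus_equation_iff)
  interpret R: right_moving "reflect f" "reflect_measure \<mu>" "uminus ` Sg" "\<lambda>x t. - S (- x) t"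
  proof (intro right_moving.intro flow_data_reflect RF.real_flow_axioms right_moving_axioms.intro)
    fix x
    show "caratheodory_sol (reflect f) x (\<lambda>t. - S (- x) t)"
      by (rule caratheodory_sol_reflect) (simp add: sol)
    show "uminus ` Sg \<subseteq> RF.Z" using SgZ by (auto simp: RZ)
    show "emeasure (reflect_measure \<mu>) {z..y} = \<infinity>" if "z \<in> RF.Z" "z \<notin> uminus ` Sg" "z < y" for z y
    proof -
      have "- z \<in> Z" "- z \<notin> Sg" "- y < - z" using that by (auto simp: RZ mem_uminus_image)
      then have "uncountable (Z \<inter> {- y..- z})" unfolding Sg_def by blast
      then have "emeasure \<mu> {- y..- z} = \<infinity>" by (intro unc) (auto simp: Int_commute)
      then show ?thesis using emeasure_reflect[OF \<mu>(1), of "{- y..- z}"] by simp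
    qed
    fix q assume x: "RF.up x" "0 \<le> q" "- S (- x) q \<notin> RF.Z"
    have "S (- x) q \<notin> Z" using x(3) by (simp add: RZ)
    then have "emeasure \<mu> {S (- x) q..- x}
        = emeasure lborel {t\<in>{0..q}. f (S (- x) t) = 0 \<and> S (- x) t \<in> {S (- x) q..- x}}"
      using x(2) by (intro occ_seg) auto
    moreover have "S (- x) t \<in> {S (- x) q..- x}" if "0 \<le> t" "t \<le> q" for t
      using RF.up_mono[OF x(1), of 0 t] RF.up_mono[OF x(1), of t q] that by simp
    then have "{t\<in>{0..q}. f (S (- x) t) = 0 \<and> S (- x) t \<in> {S (- x) q..- x}}
        = {t\<in>{0..q}. reflect f (- S (- x) t) = 0}"
      by (auto simp: reflect_def)
    ultimately show "emeasure (reflect_measure \<mu>) {x..- S (- x) q}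
        = emeasure lborel {t\<in>{0..q}. reflect f (- S (- x) t) = 0}"
      using emeasure_reflect[OF \<mu>(1), of "{S (- x) q..- x}"] by simp
  qed
  \<comment> \<open>At a point admitting both directions, Phi records the one that S takes.\<close>
  define \<Phi> :: "real \<Rightarrow> int" where "\<Phi> x = (if up x then 1 else -1)" for x
  have "S x t = constructed_semigroup f \<mu> Sg \<Phi> x t" if t: "0 \<le> t" for x t
  proof -
    consider "up x" | "down x" | "x \<in> Z" using up_down_cases by blast
    then show ?thesis
    proof cases
      case 1
      have "x \<in> U_plus f \<mu> Sg" using up_U_plus[OF 1] by (simp add: U_plus_iff)
      then have "constructed_semigroup f \<mu> Sg \<Phi> x t = flow_right x t"
        by (rule constructed_right) (simp add: \<Phi>_def 1)
      then show ?thesis using flow_right_eq[OF 1 t] by simp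
    next
      case 2
      then have u: "RF.up (- x)" by (auto simp: RF.up_def down_def)
      have "x \<in> U_minus f \<mu> Sg"
        using R.up_U_plus[OF u] by (simp add: U_minus_iff_U_plus R.U_plus_iff)
      moreover have "\<not> up x" using 2 up_not_down by blast
      ultimately have "constructed_semigroup f \<mu> Sg \<Phi> x t = - R.flow_right (- x) t"
        using t by (intro constructed_left) (auto simp: \<Phi>_def)
      then show ?thesis using R.flow_right_eq[OF u t] by simp
    next
      case 3
      have "x \<notin> U_plus f \<mu> Sg" using Z_not_U_plus[OF 3] by (simp add: U_plus_iff)
      moreover have "x \<notin> U_minus f \<mu> Sg"
        using R.Z_not_U_plus[of "- x"] 3 by (simp add: U_minus_iff_U_plus R.U_plus_iff RZ)
      ultimately show ?thesis using Z_fixed[OF 3 t] by (simp add: constructed_fixed)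
    qed
  qed
  then show ?thesis
    using data cSg by (intro exI[of _ \<mu>] exI[of _ Sg] exI[of _ \<Phi>]) (auto simp: \<Phi>_def)
qed

theorem theorem3p5:
  fixes f :: "real \<Rightarrow> real" and S :: "real \<Rightarrow> real \<Rightarrow> real"
  assumes "A1 f" and "A2 f"
  shows "det_semigroup f S \<longleftrightarrow>
    (\<exists>(\<mu>::real measure) (Sg::real set) (\<Phi>::real \<Rightarrow> int).
        sets \<mu> = sets borel \<and>
        (\<forall>x. emeasure \<mu> {x} = 0) \<and>
        emeasure \<mu> (UNIV - f -` {0}) = 0 \<and>
        countable Sg \<and> Sg \<subseteq> f -` {0} \<and>
        (\<forall>x\<in>Omega_star f. \<Phi> x \<in> {-1, 1}) \<and>
        (\<forall>x0 t. 0 \<le> t \<longrightarrow> S x0 t = constructed_semigroup f \<mu> Sg \<Phi> x0 t))"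
  (is "?L \<longleftrightarrow> ?R")
proof
  assume ?L
  from det_semigroup_ex_construction[OF assms(1) this] obtain \<mu> Sg \<Phi> where
    data: "flow_data f \<mu> Sg" and *: "countable Sg" "\<forall>x. \<Phi> x \<in> {-1, 1 :: int}"
      "\<forall>x t. 0 \<le> t \<longrightarrow> S x t = constructed_semigroup f \<mu> Sg \<Phi> x t" by blast
  show ?R
    using data[unfolded flow_data_def] *
    by (intro exI[of _ \<mu>] exI[of _ Sg] exI[of _ \<Phi>] conjI) blast+
next
  assume ?R
  then obtain \<mu> Sg \<Phi> where "sets \<mu> = sets borel" "\<forall>x. emeasure \<mu> {x} = 0"
    "emeasure \<mu> (UNIV - f -` {0}) = 0" "Sg \<subseteq> f -` {0}"
    and eq: "\<forall>x0 t. 0 \<le> t \<longrightarrow> S x0 t = constructed_semigroup f \<mu> Sg \<Phi> x0 t" by blast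
  then interpret flow_data f \<mu> Sg using assms by unfold_locales auto
  show ?L
    by (rule det_semigroup_cong[OF _ det_semigroup_constructed[OF assms(2)]]) (simp add: eq)
qed

end
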